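(* Let $d$ be a prime, $n\ge 1$, $0\le k\le n$, and let $L\subset\mathbb{F}_d^{2n}$ be a subspace with $L\subset L^{\perp}$ and $\dim L=n-k$. Fix hyperbolic pairs adapted to $L$, a unit vector $\ket{\overline{0^n}}$, the resulting code subspaces $\mathcal{C}^{(s)}$, coset representatives $\hat{x}(t)$, and the maps $\mathcal{R}^{(s,t)}$, all as described in the context. Then for every $t\in\mathbb{F}_d^{n-k}$ and every trace-preserving completely positive map $\mathcal{A}:\mathcal{B}(\mathcal{H}^{\otimes n})\to\mathcal{B}(\mathcal{H}^{\otimes n})$, $$\frac{1}{d^{n-k}}\sum_{s\in\mathbb{F}_d^{n-k}}F_{\rm e}\big(\pi_{\mathcal{C}^{(s)}},\mathcal{R}^{(s,t)}\mathcal{A}\big)=\sum_{x\in\hat{x}(t)+L}P_{\mathcal{A}}(x),$$ where $P_{\mathcal{A}}(x)=\bra{\Psi_x}[\mathrm{Id}\otimes\mathcal{A}](\ket{\Psi}\bra{\Psi})\ket{\Psi_x}$.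
   Context: $\mathcal{H}$ is a Hilbert space of prime dimension $d$ with orthonormal basis $\ket{0},\dots,\ket{d-1}$ indexed by $\mathbb{F}_d=\mathbb{Z}/d\mathbb{Z}$; $\omega$ is a primitive $d$-th root of unity. Define unitaries $X\ket{a}=\ket{a-1}$, $Z\ket{a}=\omega^a\ket{a}$, and for $(a,b)\in\mathbb{F}_d^2$ put $N_{(a,b)}=i^{ab}X^aZ^b$ if $d=2$ and $N_{(a,b)}=X^aZ^b$ if $d>2$. Identify $((x_1,z_1),\dots,(x_n,z_n))$ with $y=(x_1,z_1,\dots,x_n,z_n)\in\mathbb{F}_d^{2n}$ and set $N_y=N_{(x_1,z_1)}\otimes\cdots\otimes N_{(x_n,z_n)}$. The symplectic form is $\langle y,y'\rangle=\sum_{i=1}^n(x_iz_i'-z_ix_i')$, and $L^{\perp}=\{y:\langle x,y\rangle=0\ \forall x\in L\}$. For $l=(l_1,\dots,l_n)\in\mathbb{F}_d^n$ write $\ket{l}=\ket{l_1}\otimes\cdots\otimes\ket{l_n}$; $\ket{\Psi_y}=d^{-n/2}\sum_{l\in\mathbb{F}_d^n}\ket{l}\otimes N_y\ket{l}$ for $y\in\mathbb{F}_d^{2n}$, and $\ket{\Psi}=\ket{\Psi_{0}}$; $\mathrm{Id}$ is the identity map on $\mathcal{B}(\mathcal{H}^{\otimes n})$. Hyperbolic pairs adapted to $L$: vectors $g_1,\dots,g_n,h_1,\dots,h_n\in\mathbb{F}_d^{2n}$ with $g_1,\dots,g_{n-k}$ a basis of $L$ and $\langle g_i,h_j\rangle=\delta_{ij}$,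 $\langle g_i,g_j\rangle=0$, $\langle h_i,h_j\rangle=0$. Let $\ket{\overline{0^n}}$ be a unit vector with $N_{g_i}\ket{\overline{0^n}}=\ket{\overline{0^n}}$ for all $i$, and $\ket{\overline{l}}=\prod_{i=1}^n(N_{h_i})^{l_i}\ket{\overline{0^n}}$ for $l\in\mathbb{F}_d^n$. For $s\in\mathbb{F}_d^{n-k}$, $\mathcal{C}^{(s)}=\mathrm{span}\{\ket{\overline{(s,u)}}:u\in\mathbb{F}_d^k\}$, $\Pi_s$ is the orthogonal projection onto it, and $\pi_{\mathcal{C}^{(s)}}=\Pi_s/d^k$. For each $t\in\mathbb{F}_d^{n-k}$, $\hat{x}(t)$ is a chosen element of $\{x:\langle g_i,x\rangle=t_i,\ i=1,\dots,n-k\}$. $\mathcal{R}^{(s,t)}$ is $\sigma\mapsto R_t^{(s)}\sigma R_t^{(s)\dagger}$ with $R_t^{(s)}=N_{\hat{x}(t)}^{\dagger}\Pi_{t+s}$. $F_{\rm e}(\rho,\mathcal{E})=\sum_j|\mathrm{tr}(\rho E_j)|^2$ for a completely positive map $\mathcal{E}$ with Kraus operators $E_j$ (unnormalized entanglement fidelity). $\mathcal{M}\mathcal{L}$ denotes composition. *)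

theory Defs
  imports "HOL-Analysis.Analysis" "Berlekamp_Zassenhaus.Finite_Field"
begin

text \<open>Vectors are functions S -> complex, operators are matrices S x S -> complex
  (only values on S matter, except where op_on is required).\<close>

type_synonym 'a vec = "'a \<Rightarrow> complex"
type_synonym 'a op = "'a \<Rightarrow> 'a \<Rightarrow> complex"

definition op_on :: "'a set \<Rightarrow> 'a op \<Rightarrow> bool" where
  "op_on S A \<longleftrightarrow> (\<forall>a b. (a \<notin> S \<or> b \<notin> S) \<longrightarrow> A a b = 0)"

definition ident :: "'a set \<Rightarrow> 'a op" where
  "ident S = (\<lambda>a b. if a = b \<and> a \<in> S then 1 else 0)"

definition mmul :: "'a set \<Rightarrow> 'a op \<Rightarrow> 'a op \<Rightarrow> 'a op" where
  "mmul S A B = (\<lambda>a c. \<Sum>b\<in>S. A a b * B b c)"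

definition opow :: "'a set \<Rightarrow> 'a op \<Rightarrow> nat \<Rightarrow> 'a op" where
  "opow S A m = ((mmul S A) ^^ m) (ident S)"

definition adj :: "'a op \<Rightarrow> 'a op" where
  "adj A = (\<lambda>a b. cnj (A b a))"

definition mapply :: "'a set \<Rightarrow> 'a op \<Rightarrow> 'a vec \<Rightarrow> 'a vec" where
  "mapply S A v = (\<lambda>a. \<Sum>b\<in>S. A a b * v b)"

definition inner :: "'a set \<Rightarrow> 'a vec \<Rightarrow> 'a vec \<Rightarrow> complex" where
  "inner S u v = (\<Sum>a\<in>S. cnj (u a) * v a)"

definition trace :: "'a set \<Rightarrow> 'a op \<Rightarrow> complex" where
  "trace S A = (\<Sum>a\<in>S. A a a)"

definition outer :: "'a vec \<Rightarrow> 'a vec \<Rightarrow> 'a op" where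
  "outer u v = (\<lambda>a b. u a * cnj (v b))"

definition cspan :: "'a vec set \<Rightarrow> 'a vec set" where
  "cspan V = {(\<lambda>a. \<Sum>v\<in>V. c v * v a) | c. True}"

definition orth_proj :: "'a set \<Rightarrow> 'a vec set \<Rightarrow> 'a op" where
  "orth_proj S W = (THE P. op_on S P
      \<and> (\<forall>v\<in>W. \<forall>a\<in>S. mapply S P v a = v a)
      \<and> (\<forall>w. (\<forall>v\<in>W. inner S v w = 0) \<longrightarrow> (\<forall>a\<in>S. mapply S P w a = 0)))"

text \<open>A completely positive map on B(span S) is given by a finite list of Kraus operators.\<close>
definition trace_preserving :: "'a set \<Rightarrow> 'a op list \<Rightarrow> bool" where
  "trace_preserving S Ks \<longleftrightarrow>
     (\<forall>a\<in>S. \<forall>c\<in>S. (\<Sum>K\<leftarrow>Ks. mmul S (adj K) K a c) = ident S a c)"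

definition cp_apply :: "'a set \<Rightarrow> 'a op list \<Rightarrow> 'a op \<Rightarrow> 'a op" where
  "cp_apply S Ks \<rho> = (\<lambda>a b. \<Sum>K\<leftarrow>Ks. mmul S (mmul S K \<rho>) (adj K) a b)"

definition cp_comp :: "'a set \<Rightarrow> 'a op list \<Rightarrow> 'a op list \<Rightarrow> 'a op list" where
  "cp_comp S Ms Ls = [mmul S M L. M \<leftarrow> Ms, L \<leftarrow> Ls]"

definition ent_fid :: "'a set \<Rightarrow> 'a op \<Rightarrow> 'a op list \<Rightarrow> real" where
  "ent_fid S \<rho> Ks = (\<Sum>K\<leftarrow>Ks. (cmod (trace S (mmul S \<rho> K)))\<^sup>2)"

definition id_tensor :: "'a op \<Rightarrow> ('a \<times> 'a) op" where
  "id_tensor K = (\<lambda>(a,b) (a',b'). (if a = a' then 1 else 0) * K b b')"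

definition id_tensor_cp :: "'a set \<Rightarrow> 'a op list \<Rightarrow> ('a \<times> 'a) op \<Rightarrow> ('a \<times> 'a) op" where
  "id_tensor_cp S Ks \<rho> = cp_apply (S \<times> S) (map id_tensor Ks) \<rho>"

section \<open>Qudits: H = C^d with basis indexed by F_d = 'p mod_ring, d = CARD('p) prime\<close>

definition nat_of :: "'p::finite mod_ring \<Rightarrow> nat" where
  "nat_of a = nat (to_int_mod_ring a)"

definition Xop :: "'p::prime_card mod_ring op" where
  "Xop = (\<lambda>b a. if b = a - 1 then 1 else 0)"

definition Zop :: "complex \<Rightarrow> 'p::prime_card mod_ring op" where
  "Zop \<omega> = (\<lambda>b a. if b = a then \<omega> ^ nat_of a else 0)"

definition Nsingle :: "complex \<Rightarrow> 'p::prime_card mod_ring \<Rightarrow> 'p mod_ring \<Rightarrow> 'p mod_ring op" where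
  "Nsingle \<omega> a b =
     (\<lambda>r c. (if CARD('p) = 2 then \<i> ^ (nat_of a * nat_of b) else 1) *
        mmul UNIV (opow UNIV Xop (nat_of a)) (opow UNIV (Zop \<omega>) (nat_of b)) r c)"

text \<open>Basis of H^{tensor n}: lists of length n over F_d.\<close>
definition Bn :: "nat \<Rightarrow> 'p::finite mod_ring list set" where
  "Bn n = {l. length l = n}"

text \<open>y = (x_1,z_1,...,x_n,z_n) as a list of length 2n; N_y = tensor of N_(x_i,z_i).\<close>
definition Npauli :: "complex \<Rightarrow> nat \<Rightarrow> 'p::prime_card mod_ring list \<Rightarrow> 'p mod_ring list op" where
  "Npauli \<omega> n y = (\<lambda>l l'. if length l = n \<and> length l' = n then
       (\<Prod>i<n. Nsingle \<omega> (y ! (2*i)) (y ! (2*i+1)) (l ! i) (l' ! i)) else 0)"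

definition vadd :: "'p::prime_card mod_ring list \<Rightarrow> 'p mod_ring list \<Rightarrow> 'p mod_ring list" where
  "vadd u v = map2 (+) u v"

definition vscale :: "'p::prime_card mod_ring \<Rightarrow> 'p mod_ring list \<Rightarrow> 'p mod_ring list" where
  "vscale c v = map (\<lambda>x. c * x) v"

definition symp :: "nat \<Rightarrow> 'p::prime_card mod_ring list \<Rightarrow> 'p mod_ring list \<Rightarrow> 'p mod_ring" where
  "symp n y y' = (\<Sum>i<n. y ! (2*i) * y' ! (2*i+1) - y ! (2*i+1) * y' ! (2*i))"

definition symp_perp :: "nat \<Rightarrow> 'p::prime_card mod_ring list set \<Rightarrow> 'p mod_ring list set" where
  "symp_perp n L = {y. length y = 2*n \<and> (\<forall>x\<in>L. symp n x y = 0)}"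

definition subspace_Fd :: "nat \<Rightarrow> 'p::prime_card mod_ring list set \<Rightarrow> bool" where
  "subspace_Fd m L \<longleftrightarrow> L \<subseteq> {v. length v = m} \<and> replicate m 0 \<in> L
     \<and> (\<forall>u\<in>L. \<forall>v\<in>L. vadd u v \<in> L) \<and> (\<forall>c. \<forall>v\<in>L. vscale c v \<in> L)"

definition lin_comb :: "nat \<Rightarrow> (nat \<Rightarrow> 'p::prime_card mod_ring) \<Rightarrow> (nat \<Rightarrow> 'p mod_ring list) \<Rightarrow> nat \<Rightarrow> 'p mod_ring list" where
  "lin_comb m c g r = map (\<lambda>j. \<Sum>i<r. c i * g i ! j) [0..<m]"

definition is_basis :: "nat \<Rightarrow> 'p::prime_card mod_ring list set \<Rightarrow> (nat \<Rightarrow> 'p mod_ring list) \<Rightarrow> nat \<Rightarrow> bool" where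
  "is_basis m L g r \<longleftrightarrow> (\<forall>i<r. g i \<in> L)
     \<and> (\<forall>c. lin_comb m c g r = replicate m 0 \<longrightarrow> (\<forall>i<r. c i = 0))
     \<and> (\<forall>v\<in>L. \<exists>c. v = lin_comb m c g r)"

definition dim_Fd :: "nat \<Rightarrow> 'p::prime_card mod_ring list set \<Rightarrow> nat \<Rightarrow> bool" where
  "dim_Fd m L r \<longleftrightarrow> (\<exists>g. is_basis m L g r)"

definition hyperbolic_adapted ::
  "nat \<Rightarrow> nat \<Rightarrow> 'p::prime_card mod_ring list set \<Rightarrow> (nat \<Rightarrow> 'p mod_ring list) \<Rightarrow> (nat \<Rightarrow> 'p mod_ring list) \<Rightarrow> bool" where
  "hyperbolic_adapted n k L g h \<longleftrightarrow>
     (\<forall>i<n. length (g i) = 2*n \<and> length (h i) = 2*n)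
     \<and> is_basis (2*n) L g (n-k)
     \<and> (\<forall>i<n. \<forall>j<n. symp n (g i) (h j) = (if i = j then 1 else 0)
                 \<and> symp n (g i) (g j) = 0 \<and> symp n (h i) (h j) = 0)"

definition logical_ket :: "complex \<Rightarrow> nat \<Rightarrow> (nat \<Rightarrow> 'p::prime_card mod_ring list) \<Rightarrow>
    'p mod_ring list vec \<Rightarrow> 'p mod_ring list \<Rightarrow> 'p mod_ring list vec" where
  "logical_ket \<omega> n h v0 l =
     foldr (\<lambda>i w. mapply (Bn n) (opow (Bn n) (Npauli \<omega> n (h i)) (nat_of (l ! i))) w) [0..<n] v0"

definition code_proj :: "complex \<Rightarrow> nat \<Rightarrow> nat \<Rightarrow> (nat \<Rightarrow> 'p::prime_card mod_ring list) \<Rightarrow>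
    'p mod_ring list vec \<Rightarrow> 'p mod_ring list \<Rightarrow> 'p mod_ring list op" where
  "code_proj \<omega> n k h v0 s =
     orth_proj (Bn n) (cspan ((\<lambda>u. logical_ket \<omega> n h v0 (s @ u)) ` {u. length u = k}))"

definition recovery_op :: "complex \<Rightarrow> nat \<Rightarrow> nat \<Rightarrow> (nat \<Rightarrow> 'p::prime_card mod_ring list) \<Rightarrow>
    'p mod_ring list vec \<Rightarrow> ('p mod_ring list \<Rightarrow> 'p mod_ring list) \<Rightarrow>
    'p mod_ring list \<Rightarrow> 'p mod_ring list \<Rightarrow> 'p mod_ring list op" where
  "recovery_op \<omega> n k h v0 xhat s t =
     mmul (Bn n) (adj (Npauli \<omega> n (xhat t))) (code_proj \<omega> n k h v0 (vadd t s))"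

text \<open>|Psi_y> = d^{-n/2} sum_l |l> tensor N_y |l>.\<close>
definition Psi :: "complex \<Rightarrow> nat \<Rightarrow> 'p::prime_card mod_ring list \<Rightarrow> ('p mod_ring list \<times> 'p mod_ring list) vec" where
  "Psi \<omega> n y = (\<lambda>(a,b). if a \<in> Bn n then
       complex_of_real (real CARD('p) powr (- real n / 2)) * Npauli \<omega> n y b a else 0)"

definition P_err :: "complex \<Rightarrow> nat \<Rightarrow> 'p::prime_card mod_ring list op list \<Rightarrow> 'p mod_ring list \<Rightarrow> complex" where
  "P_err \<omega> n As x =
     (let S2 = Bn n \<times> Bn n;
          \<rho> = id_tensor_cp (Bn n) As (outer (Psi \<omega> n (replicate (2*n) 0)) (Psi \<omega> n (replicate (2*n) 0)))
      in inner S2 (Psi \<omega> n x) (mapply S2 \<rho> (Psi \<omega> n x)))"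

end

theory Submission
  imports Defs
begin

text \<open>
  The logical kets are joint eigenvectors of the \<open>N\<close> of the \<open>g i\<close> with distinct eigenvalue tuples, and
  there are \<open>d ^ n\<close> of them, so they form an orthonormal basis. For \<open>y = \<Sum>i. c i * g i\<close> in \<open>L\<close>,
  the operator \<open>N y\<close> multiplies the ket of \<open>(s, u)\<close> by \<open>\<omega> ^ (c \<bullet> s)\<close>, up to a phase depending only
  on \<open>y\<close>. Put \<open>\<tau> s = \<Sum>u. \<langle>N x (s,u) | A (s,u)\<rangle>\<close> for a Kraus operator \<open>A\<close> and \<open>x = xhat t\<close>. Since
  \<open>N x\<close> maps the code space of \<open>s\<close> into that of \<open>t + s\<close>, the fidelity for \<open>s\<close> is
  \<open>|\<tau> s|\<^sup>2 / d ^ (2 k)\<close>. On the other side, \<open>P (x + y) = |tr (N (x + y)\<^sup>\<dagger> A)|\<^sup>2 / d ^ (2 n)\<close>,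
  and this trace, computed in the logical basis, is up to a phase the Fourier transform of \<open>\<tau>\<close>
  at \<open>c\<close>. The theorem is Parseval's identity on \<open>F_d ^ (n - k)\<close>, summed over the Kraus operators.
\<close>

section \<open>Finite-dimensional linear algebra\<close>

text \<open>\<open>mapply\<close> reads its vector only on \<open>S\<close> but returns a function
  on the whole type. Hence agreement of the arguments on \<open>S\<close> already gives equal
  functions, whereas replacing the operator, as in \<open>mapply_cong_op\<close>, is justified only
  at points of \<open>S\<close>.\<close>

lemma mapply_cong:
  assumes "\<And>b. b \<in> S \<Longrightarrow> u b = v b"
  shows "mapply S A u = mapply S A v"
  using assms by (auto simp: mapply_def)

lemma inner_cong:
  assumes "\<And>a. a \<in> S \<Longrightarrow> u a = u' a" "\<And>a. a \<in> S \<Longrightarrow> v a = v' a"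
  shows "inner S u v = inner S u' v'"
  using assms by (auto simp: inner_def intro!: sum.cong)

lemma mapply_cong_op:
  assumes "\<And>a b. a \<in> S \<Longrightarrow> b \<in> S \<Longrightarrow> A a b = B a b" "a \<in> S"
  shows "mapply S A u a = mapply S B u a"
  using assms by (auto simp: mapply_def intro!: sum.cong)

lemma mapply_mmul:
  "mapply S (mmul S A B) v = mapply S A (mapply S B v)"
proof
  fix a
  have "mapply S (mmul S A B) v a = (\<Sum>b\<in>S. \<Sum>c\<in>S. A a c * B c b * v b)"
    by (simp add: mapply_def mmul_def sum_distrib_right)
  also have "\<dots> = (\<Sum>c\<in>S. \<Sum>b\<in>S. A a c * B c b * v b)"
    by (rule sum.swap)
  also have "\<dots> = mapply S A (mapply S B v) a"
    by (simp add: mapply_def sum_distrib_left mult.assoc)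
  finally show "mapply S (mmul S A B) v a = mapply S A (mapply S B v) a" .
qed

lemma mapply_scale_op: "mapply S (\<lambda>a b. c * A a b) v = (\<lambda>a. c * mapply S A v a)"
  by (simp add: mapply_def sum_distrib_left mult.assoc)

lemma mapply_scale: "mapply S A (\<lambda>a. c * v a) = (\<lambda>a. c * mapply S A v a)"
  by (simp add: mapply_def sum_distrib_left algebra_simps)

lemma mapply_ident:
  assumes "finite S" "a \<in> S"
  shows "mapply S (ident S) v a = v a"
proof -
  have "mapply S (ident S) v a = (\<Sum>b\<in>S. if a = b then v b else 0)"
    unfolding mapply_def ident_def using assms(2) by (intro sum.cong) auto
  then show ?thesis using assms by simp
qed

lemma inner_scale_left: "inner S (\<lambda>a. c * u a) v = cnj c * inner S u v"
  by (simp add: inner_def sum_distrib_left mult.assoc)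

lemma inner_scale_right: "inner S u (\<lambda>a. c * v a) = c * inner S u v"
  by (simp add: inner_def sum_distrib_left algebra_simps)

lemma inner_sum_right:
  "inner S u (\<lambda>a. \<Sum>j\<in>J. f j a) = (\<Sum>j\<in>J. inner S u (f j))"
  unfolding inner_def sum_distrib_left by (rule sum.swap)

lemma inner_sum_left:
  "inner S (\<lambda>a. \<Sum>j\<in>J. f j a) v = (\<Sum>j\<in>J. inner S (f j) v)"
  unfolding inner_def cnj_sum sum_distrib_right by (rule sum.swap)

lemma inner_commute: "inner S u v = cnj (inner S v u)"
  by (simp add: inner_def mult.commute)

lemma inner_mapply_adj: "inner S u (mapply S (adj A) v) = inner S (mapply S A u) v"
proof -
  have "inner S u (mapply S (adj A) v) = (\<Sum>a\<in>S. \<Sum>b\<in>S. cnj (u a) * (cnj (A b a) * v b))"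
    by (simp add: inner_def mapply_def adj_def sum_distrib_left)
  also have "\<dots> = (\<Sum>b\<in>S. \<Sum>a\<in>S. cnj (u a) * (cnj (A b a) * v b))"
    by (rule sum.swap)
  also have "\<dots> = inner S (mapply S A u) v"
    by (simp add: inner_def mapply_def sum_distrib_left sum_distrib_right algebra_simps)
  finally show ?thesis .
qed

lemma inner_mapply_unitary:
  assumes "finite S" "\<And>a b. a \<in> S \<Longrightarrow> b \<in> S \<Longrightarrow> mmul S (adj A) A a b = ident S a b"
  shows "inner S (mapply S A u) (mapply S A v) = inner S u v"
proof -
  have "inner S (mapply S A u) (mapply S A v) = inner S u (mapply S (mmul S (adj A) A) v)"
    by (simp add: inner_mapply_adj mapply_mmul)
  also have "\<dots> = inner S u v"
  proof (rule inner_cong[OF refl])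
    fix a assume "a \<in> S"
    then show "mapply S (mmul S (adj A) A) v a = v a"
      using mapply_cong_op[of S "mmul S (adj A) A" "ident S" a v] mapply_ident[of S a v] assms
      by simp
  qed
  finally show ?thesis .
qed

section \<open>Orthonormal families, traces and orthogonal projections\<close>

definition orthonormal_on :: "'a set \<Rightarrow> 'i set \<Rightarrow> ('i \<Rightarrow> 'a vec) \<Rightarrow> bool" where
  "orthonormal_on S I e \<longleftrightarrow> (\<forall>i\<in>I. \<forall>j\<in>I. inner S (e i) (e j) = (if i = j then 1 else 0))"

text \<open>The operator \<open>Q = 1 - \<Sum>i. |e i\<rangle>\<langle>e i|\<close> has squared Hilbert-Schmidt norm
  \<open>card S - card I\<close>.\<close>
lemma orthonormal_complete:
  fixes e :: "'i \<Rightarrow> 'a vec"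
  assumes fin: "finite S" "finite I" and card: "card I = card S"
    and on: "orthonormal_on S I e" and ab: "a \<in> S" "b \<in> S"
  shows "(\<Sum>i\<in>I. e i a * cnj (e i b)) = (if a = b then 1 else 0)"
proof -
  define R where "R = (\<lambda>a b. \<Sum>i\<in>I. e i a * cnj (e i b))"
  define Q where "Q = (\<lambda>a b. (if a = b then 1 else 0) - R a b)"
  have sumR: "(\<Sum>a\<in>S. R a a) = of_nat (card S)"
  proof -
    have "(\<Sum>a\<in>S. R a a) = (\<Sum>i\<in>I. inner S (e i) (e i))"
      unfolding R_def inner_def by (subst sum.swap) (simp add: mult.commute)
    then show ?thesis using on card by (simp add: orthonormal_on_def)
  qed
  have sumR2: "(\<Sum>a\<in>S. \<Sum>b\<in>S. R a b * cnj (R a b)) = of_nat (card S)"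
  proof -
    have "(\<Sum>a\<in>S. \<Sum>b\<in>S. R a b * cnj (R a b))
        = (\<Sum>a\<in>S. \<Sum>b\<in>S. \<Sum>i\<in>I. \<Sum>j\<in>I. (cnj (e j a) * e i a) * (cnj (e i b) * e j b))"
      by (simp add: R_def sum_product algebra_simps)
    \<comment> \<open>With the index sums outermost, the sums over \<open>a\<close> and
      \<open>b\<close> separate into two inner products, so orthonormality leaves only the terms
      \<open>i = j\<close>.\<close>
    also have "\<dots> = (\<Sum>i\<in>I. \<Sum>j\<in>I. \<Sum>a\<in>S. \<Sum>b\<in>S. (cnj (e j a) * e i a) * (cnj (e i b) * e j b))"
    proof -
      have "(\<Sum>a\<in>S. \<Sum>b\<in>S. \<Sum>i\<in>I. \<Sum>j\<in>I. f a b i j) = (\<Sum>i\<in>I. \<Sum>j\<in>I. \<Sum>a\<in>S. \<Sum>b\<in>S. f a b i j)"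
        for f :: "'a \<Rightarrow> 'a \<Rightarrow> 'i \<Rightarrow> 'i \<Rightarrow> complex"
      proof -
        have "(\<Sum>a\<in>S. \<Sum>b\<in>S. \<Sum>i\<in>I. \<Sum>j\<in>I. f a b i j) = (\<Sum>i\<in>I. \<Sum>a\<in>S. \<Sum>b\<in>S. \<Sum>j\<in>I. f a b i j)"
          unfolding sum.swap[of _ S I] ..
        also have "\<dots> = (\<Sum>i\<in>I. \<Sum>j\<in>I. \<Sum>a\<in>S. \<Sum>b\<in>S. f a b i j)"
          unfolding sum.swap[of _ S I] ..
        finally show ?thesis .
      qed
      then show ?thesis .
    qed
    also have "\<dots> = (\<Sum>i\<in>I. \<Sum>j\<in>I. inner S (e j) (e i) * inner S (e i) (e j))"
      by (simp add: inner_def sum_product)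
    also have "\<dots> = (\<Sum>i\<in>I. \<Sum>j\<in>I. if i = j then 1 else 0)"
      using on by (intro sum.cong) (auto simp: orthonormal_on_def)
    also have "\<dots> = of_nat (card S)"
      using fin card by simp
    finally show ?thesis .
  qed
  have "complex_of_real (\<Sum>a\<in>S. \<Sum>b\<in>S. (cmod (Q a b))\<^sup>2) = (\<Sum>a\<in>S. \<Sum>b\<in>S. Q a b * cnj (Q a b))"
    by (simp add: complex_norm_square flip: of_real_power)
  also have "\<dots> = (\<Sum>a\<in>S. \<Sum>b\<in>S. (if a = b then 1 else 0) - (if a = b then R b b else 0)
      - (if a = b then cnj (R b b) else 0) + R a b * cnj (R a b))"
    by (intro sum.cong) (auto simp: Q_def algebra_simps)
  also have "\<dots> = of_nat (card S) - (\<Sum>a\<in>S. R a a) - cnj (\<Sum>a\<in>S. R a a)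
      + (\<Sum>a\<in>S. \<Sum>b\<in>S. R a b * cnj (R a b))"
    using fin by (simp add: sum.distrib sum_subtractf)
  also have "\<dots> = 0"
    unfolding sumR sumR2 by simp
  finally have "(\<Sum>a\<in>S. \<Sum>b\<in>S. (cmod (Q a b))\<^sup>2) = 0"
    using of_real_eq_0_iff by blast
  then have "(\<Sum>b\<in>S. (cmod (Q a b))\<^sup>2) = 0"
    using fin ab by (subst (asm) sum_nonneg_eq_0_iff) (auto intro: sum_nonneg)
  then have "(cmod (Q a b))\<^sup>2 = 0"
    using fin ab by (subst (asm) sum_nonneg_eq_0_iff) auto
  then show ?thesis by (simp add: Q_def R_def)
qed

lemma orthonormal_expansion:
  assumes "finite S" "finite I" "card I = card S" "orthonormal_on S I e" "a \<in> S"
  shows "(\<Sum>i\<in>I. inner S (e i) v * e i a) = v a"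
proof -
  have "(\<Sum>i\<in>I. inner S (e i) v * e i a) = (\<Sum>b\<in>S. (\<Sum>i\<in>I. e i a * cnj (e i b)) * v b)"
    unfolding inner_def sum_distrib_right by (subst sum.swap) (simp add: algebra_simps)
  also have "\<dots> = (\<Sum>b\<in>S. if a = b then v b else 0)"
    using assms by (intro sum.cong) (auto simp: orthonormal_complete)
  also have "\<dots> = v a" using assms by simp
  finally show ?thesis .
qed

text \<open>The cut-off outside \<open>S\<close> makes this an operator in the sense of
  \<open>op_on\<close>, so that it can equal \<open>orth_proj\<close> as a function and not only on
  \<open>S\<close>.\<close>

definition onb_proj :: "'a set \<Rightarrow> 'i set \<Rightarrow> ('i \<Rightarrow> 'a vec) \<Rightarrow> 'a op" where
  "onb_proj S J e = (\<lambda>a b. if a \<in> S \<and> b \<in> S then \<Sum>j\<in>J. e j a * cnj (e j b) else 0)"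

lemma mapply_onb_proj:
  assumes "a \<in> S"
  shows "mapply S (onb_proj S J e) v a = (\<Sum>j\<in>J. inner S (e j) v * e j a)"
proof -
  have "mapply S (onb_proj S J e) v a = (\<Sum>b\<in>S. \<Sum>j\<in>J. e j a * cnj (e j b) * v b)"
    using assms by (simp add: mapply_def onb_proj_def sum_distrib_right)
  also have "\<dots> = (\<Sum>j\<in>J. inner S (e j) v * e j a)"
    unfolding inner_def sum_distrib_right by (subst sum.swap) (simp add: algebra_simps)
  finally show ?thesis .
qed

lemma adj_onb_proj: "adj (onb_proj S J e) = onb_proj S J e"
  by (intro ext) (simp add: adj_def onb_proj_def mult.commute)

lemma trace_mmul_onb_proj:
  "trace S (mmul S (onb_proj S J e) B) = (\<Sum>j\<in>J. inner S (e j) (mapply S B (e j)))"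
proof -
  have "trace S (mmul S (onb_proj S J e) B)
      = (\<Sum>a\<in>S. \<Sum>b\<in>S. \<Sum>j\<in>J. e j a * cnj (e j b) * B b a)"
    by (simp add: trace_def mmul_def onb_proj_def sum_distrib_right)
  also have "\<dots> = (\<Sum>b\<in>S. \<Sum>a\<in>S. \<Sum>j\<in>J. e j a * cnj (e j b) * B b a)"
    by (rule sum.swap)
  also have "\<dots> = (\<Sum>b\<in>S. \<Sum>j\<in>J. cnj (e j b) * mapply S B (e j) b)"
    unfolding mapply_def sum_distrib_left
    by (intro sum.cong refl, subst sum.swap) (simp add: algebra_simps)
  also have "\<dots> = (\<Sum>j\<in>J. inner S (e j) (mapply S B (e j)))"
    unfolding inner_def by (rule sum.swap)
  finally show ?thesis .
qed

text \<open>By completeness the projection onto the whole family is the identity on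
  \<open>S\<close>, and inserting it leaves the trace unchanged.\<close>

lemma trace_onb:
  assumes "finite S" "finite I" "card I = card S" "orthonormal_on S I e"
  shows "trace S B = (\<Sum>i\<in>I. inner S (e i) (mapply S B (e i)))"
proof -
  have "trace S (mmul S (onb_proj S I e) B) = (\<Sum>a\<in>S. \<Sum>b\<in>S. if a = b then B b a else 0)"
    unfolding trace_def mmul_def
    using assms by (intro sum.cong) (auto simp: onb_proj_def orthonormal_complete)
  then have "trace S (mmul S (onb_proj S I e) B) = trace S B"
    using assms by (simp add: trace_def)
  then show ?thesis by (simp add: trace_mmul_onb_proj)
qed

lemma orthonormal_inj_on: "orthonormal_on S J e \<Longrightarrow> inj_on e J"
  unfolding orthonormal_on_def inj_on_def by (metis zero_neq_one)

text \<open>The conditions defining \<open>orth_proj\<close> prescribe an operator on the span and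
  on its orthogonal complement. Every vector is the sum of its expansion in \<open>e\<close> and a
  residual orthogonal to the span, so at most one operator qualifies, and \<open>onb_proj\<close>
  does.\<close>

lemma orth_proj_cspan_orthonormal:
  assumes fin: "finite S" "finite J" and on: "orthonormal_on S J e"
  shows "orth_proj S (cspan (e ` J)) = onb_proj S J e"
proof -
  let ?W = "cspan (e ` J)" and ?P = "onb_proj S J e"
  \<comment> \<open>\<open>cspan\<close> indexes coefficients by vectors. Orthonormal vectors are
    distinct, so coefficients may be indexed by \<open>J\<close> instead.\<close>
  have span: "?W = {(\<lambda>a. \<Sum>j\<in>J. c j * e j a) | c. True}"
  proof (intro equalityI subsetI)
    fix v assume "v \<in> ?W"
    then obtain c where "v = (\<lambda>a. \<Sum>w\<in>e ` J. c w * w a)" by (auto simp: cspan_def)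
    then have "v = (\<lambda>a. \<Sum>j\<in>J. (c \<circ> e) j * e j a)"
      by (simp add: sum.reindex[OF orthonormal_inj_on[OF on]])
    then show "v \<in> {(\<lambda>a. \<Sum>j\<in>J. c j * e j a) | c. True}" by blast
  next
    fix v assume "v \<in> {(\<lambda>a. \<Sum>j\<in>J. c j * e j a) | c. True}"
    then obtain c where v: "v = (\<lambda>a. \<Sum>j\<in>J. c j * e j a)" by blast
    have "v = (\<lambda>a. \<Sum>w\<in>e ` J. (c \<circ> inv_into J e) w * w a)"
      unfolding v sum.reindex[OF orthonormal_inj_on[OF on]]
      by (intro ext sum.cong) (auto simp: orthonormal_inj_on[OF on])
    then show "v \<in> ?W" unfolding cspan_def by blast
  qed
  have coeff: "inner S (e i) (\<lambda>a. \<Sum>j\<in>J. c j * e j a) = c i" if "i \<in> J" for i c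
  proof -
    have "inner S (e i) (\<lambda>a. \<Sum>j\<in>J. c j * e j a) = (\<Sum>j\<in>J. if i = j then c j else 0)"
      unfolding inner_sum_right inner_scale_right
      using on that by (intro sum.cong) (auto simp: orthonormal_on_def)
    then show ?thesis using fin that by simp
  qed
  have in_W: "e j \<in> ?W" if "j \<in> J" for j
    unfolding span using fin that
    by (intro CollectI exI[of _ "\<lambda>i. if i = j then 1 else 0"])
       (auto simp: if_distrib[of "\<lambda>x. x * _"] cong: if_cong)
  have fixes_W: "mapply S ?P v a = v a" if "v \<in> ?W" "a \<in> S" for v a
    using that unfolding span by (auto simp: mapply_onb_proj coeff)
  have kills: "mapply S ?P w a = 0" if "\<forall>v\<in>?W. inner S v w = 0" "a \<in> S" for w a
    using that in_W by (simp add: mapply_onb_proj)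
  have residual: "inner S v (\<lambda>a. w a - (\<Sum>j\<in>J. inner S (e j) w * e j a)) = 0" if "v \<in> ?W" for v w
  proof -
    obtain c where v: "v = (\<lambda>a. \<Sum>j\<in>J. c j * e j a)" using \<open>v \<in> ?W\<close> unfolding span by blast
    have diff: "inner S u (\<lambda>a. w a - x a) = inner S u w - inner S u x" for u x
      by (simp add: inner_def sum_subtractf algebra_simps)
    show ?thesis
      unfolding v inner_sum_left inner_scale_left diff by (simp add: coeff)
  qed
  show ?thesis
    unfolding orth_proj_def
  proof (rule the_equality)
    show "op_on S ?P \<and> (\<forall>v\<in>?W. \<forall>a\<in>S. mapply S ?P v a = v a)
      \<and> (\<forall>w. (\<forall>v\<in>?W. inner S v w = 0) \<longrightarrow> (\<forall>a\<in>S. mapply S ?P w a = 0))"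
      using fixes_W kills by (auto simp: op_on_def onb_proj_def)
  next
    fix P assume P: "op_on S P \<and> (\<forall>v\<in>?W. \<forall>a\<in>S. mapply S P v a = v a)
      \<and> (\<forall>w. (\<forall>v\<in>?W. inner S v w = 0) \<longrightarrow> (\<forall>a\<in>S. mapply S P w a = 0))"
    have eq: "mapply S P w a = mapply S ?P w a" if "a \<in> S" for w a
    proof -
      let ?x = "\<lambda>a. \<Sum>j\<in>J. inner S (e j) w * e j a"
      have "?x \<in> ?W"
        unfolding span by (intro CollectI exI[of _ "\<lambda>j. inner S (e j) w"]) simp
      then have 1: "mapply S P ?x a = ?x a" using P that by blast
      have 2: "mapply S P (\<lambda>a. w a - ?x a) a = 0" using P that residual by blast
      have "mapply S P w a = mapply S P ?x a + mapply S P (\<lambda>a. w a - ?x a) a"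
        by (simp add: mapply_def sum.distrib[symmetric] algebra_simps)
      then show ?thesis using 1 2 that by (simp add: mapply_onb_proj)
    qed
    show "P = ?P"
    proof (intro ext)
      fix a b
      show "P a b = ?P a b"
      proof (cases "a \<in> S \<and> b \<in> S")
        case True
        \<comment> \<open>Applying an operator to a standard basis vector reads off a column, which
          turns equal action into equal entries.\<close>
        have unit: "mapply S A (\<lambda>x. if x = b then 1 else 0) a = A a b" for A :: "'a op"
          using True fin by (simp add: mapply_def if_distrib[of "\<lambda>x. _ * x"] cong: if_cong)
        show ?thesis using eq[of a "\<lambda>x. if x = b then 1 else 0"] True by (simp add: unit)
      next
        case False
        then show ?thesis using P by (auto simp: op_on_def onb_proj_def)
      qed
    qed
  qed
qed

section \<open>Characters and Weyl operators\<close>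

lemma finite_lists_length: "finite {l :: 'a::finite list. length l = m}"
  using finite_lists_length_eq[of "UNIV :: 'a set" m] by simp

lemma sum_lists_append:
  "(\<Sum>l\<in>{l. length l = m + k}. f l) =
    (\<Sum>s\<in>{s. length s = m}. \<Sum>u\<in>{u. length u = k}. f (s @ u))"
proof -
  have "(\<Sum>s\<in>{s. length s = m}. \<Sum>u\<in>{u. length u = k}. f (s @ u))
      = (\<Sum>(s, u)\<in>{s. length s = m} \<times> {u. length u = k}. f (s @ u))"
    by (rule sum.cartesian_product)
  also have "\<dots> = (\<Sum>l\<in>{l. length l = m + k}. f l)"
    by (rule sum.reindex_bij_witness[of _ "\<lambda>l. (take m l, drop m l)" "\<lambda>(s, u). s @ u"]) auto
  finally show ?thesis ..
qed

text \<open>Distributivity, with one coordinate split off at each step of the induction. It reduces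
  matrix products of tensor operators, and character sums over lists, to single-coordinate
  sums.\<close>

lemma sum_lists_prod:
  fixes f :: "nat \<Rightarrow> 'a::finite \<Rightarrow> 'b::comm_semiring_1"
  shows "(\<Sum>l\<in>{l. length l = m}. \<Prod>i<m. f i (l ! i)) = (\<Prod>i<m. \<Sum>b\<in>UNIV. f i b)"
proof (induction m arbitrary: f)
  case 0
  then show ?case by simp
next
  case (Suc m)
  have "(\<Sum>l\<in>{l. length l = Suc m}. \<Prod>i<Suc m. f i (l ! i))
      = (\<Sum>(b, l)\<in>UNIV \<times> {l. length l = m}. f 0 b * (\<Prod>i<m. f (Suc i) (l ! i)))"
    by (rule sum.reindex_bij_witness[of _ "\<lambda>(b, l). b # l" "\<lambda>l. (hd l, tl l)"])
       (auto simp: length_Suc_conv prod.lessThan_Suc_shift simp del: prod.lessThan_Suc)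
  also have "\<dots> = (\<Sum>b\<in>UNIV. f 0 b) * (\<Sum>l\<in>{l. length l = m}. \<Prod>i<m. f (Suc i) (l ! i))"
    by (simp add: sum_product sum.cartesian_product)
  also have "\<dots> = (\<Prod>i<Suc m. \<Sum>b\<in>UNIV. f i b)"
    by (simp add: Suc.IH[of "\<lambda>i. f (Suc i)"] prod.lessThan_Suc_shift del: prod.lessThan_Suc)
  finally show ?case .
qed

section \<open>Representatives of residues and the additive character\<close>

lemma of_nat_nat_of [simp]: "of_nat (nat_of a) = (a :: 'p::prime_card mod_ring)"
proof -
  have "0 \<le> to_int_mod_ring a" by transfer auto
  then show ?thesis by (simp add: nat_of_def of_nat_of_int_mod_ring)
qed

lemma nat_of_less: "nat_of (a :: 'p::prime_card mod_ring) < CARD('p)"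
  unfolding nat_of_def by transfer auto

lemma nat_of_0 [simp]: "nat_of (0 :: 'p::prime_card mod_ring) = 0"
  by (simp add: nat_of_def)

lemma nat_of_add: "nat_of (a + b :: 'p::prime_card mod_ring) = (nat_of a + nat_of b) mod CARD('p)"
proof -
  have "0 \<le> to_int_mod_ring a" "0 \<le> to_int_mod_ring b" by (transfer, auto)+
  then show ?thesis
    by (simp add: nat_of_def to_int_mod_ring_add nat_mod_distrib nat_add_distrib)
qed

lemma nat_of_mult: "nat_of (a * b :: 'p::prime_card mod_ring) = (nat_of a * nat_of b) mod CARD('p)"
proof -
  have "0 \<le> to_int_mod_ring a" "0 \<le> to_int_mod_ring b" by (transfer, auto)+
  then show ?thesis
    by (simp add: nat_of_def to_int_mod_ring_mult nat_mod_distrib nat_mult_distrib)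
qed

text \<open>The parameter \<open>ty\<close> ties the locale to the field \<open>'p mod_ring\<close>,
  since the type of \<open>\<omega>\<close> does not mention \<open>'p\<close>.\<close>

locale primitive_root =
  fixes \<omega> :: complex and ty :: "'p::prime_card itself"
  assumes root: "\<omega> ^ CARD('p) = 1"
    and primitive: "\<And>m. 0 < m \<Longrightarrow> m < CARD('p) \<Longrightarrow> \<omega> ^ m \<noteq> 1"
begin

definition chi :: "'p mod_ring \<Rightarrow> complex" where
  "chi a = \<omega> ^ nat_of a"

lemma omega_power_mod: "\<omega> ^ (m mod CARD('p)) = \<omega> ^ m"
proof -
  have "\<omega> ^ m = \<omega> ^ (CARD('p) * (m div CARD('p)) + m mod CARD('p))" by simp
  also have "\<dots> = \<omega> ^ (m mod CARD('p))"
    unfolding power_add power_mult root by simp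
  finally show ?thesis ..
qed

lemma chi_0 [simp]: "chi 0 = 1"
  by (simp add: chi_def)

lemma chi_add: "chi (a + b) = chi a * chi b"
  by (simp add: chi_def nat_of_add omega_power_mod power_add)

lemma chi_power_nat_of: "chi a ^ nat_of b = chi (a * b)"
  by (simp add: chi_def nat_of_mult omega_power_mod power_mult)

lemma chi_sum: "chi (\<Sum>i\<in>I. f i) = (\<Prod>i\<in>I. chi (f i))"
  by (induction I rule: infinite_finite_induct) (auto simp: chi_add)

lemma norm_chi [simp]: "cmod (chi a) = 1"
proof -
  have "cmod \<omega> = 1" using power_eq_1_iff[OF root] by auto
  then show ?thesis by (simp add: chi_def norm_power)
qed

lemma chi_nonzero [simp]: "chi a \<noteq> 0"
  using norm_chi[of a] by force

lemma cnj_chi_mult [simp]: "cnj (chi a) * chi a = 1"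
  using complex_norm_square[of "chi a"] by (simp add: mult.commute)

lemma cnj_chi: "cnj (chi a) = chi (- a)"
proof -
  have "chi (- a) * chi a = cnj (chi a) * chi a" by (simp flip: chi_add)
  then show ?thesis by (metis chi_nonzero mult_right_cancel)
qed

lemma chi_eq_1_iff: "chi a = 1 \<longleftrightarrow> a = 0"
proof
  assume "chi a = 1"
  then have "nat_of a = 0" using primitive[of "nat_of a"] nat_of_less[of a] by (auto simp: chi_def)
  then show "a = 0" using of_nat_nat_of[of a] by simp
qed simp

text \<open>Translating the summation variable by 1 multiplies the sum by \<open>chi a\<close>,
  which differs from 1 unless \<open>a = 0\<close>.\<close>

lemma sum_chi: "(\<Sum>b\<in>UNIV. chi (a * b)) = (if a = 0 then of_nat CARD('p) else 0)"
proof (cases "a = 0")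
  case False
  let ?T = "\<Sum>b\<in>UNIV. chi (a * b)"
  have "?T = (\<Sum>b\<in>UNIV. chi (a * (b + 1)))"
    by (rule sum.reindex_bij_witness[of _ "\<lambda>b. b + 1" "\<lambda>b. b - 1"]) auto
  also have "\<dots> = chi a * ?T"
    by (simp add: distrib_left chi_add sum_distrib_left mult.commute)
  finally have "(chi a - 1) * ?T = 0" by (simp add: algebra_simps)
  then show ?thesis using False by (simp add: chi_eq_1_iff)
qed simp

section \<open>Weyl operators on a single qudit\<close>

definition phase :: "'p mod_ring \<Rightarrow> 'p mod_ring \<Rightarrow> complex" where
  "phase a b = (if CARD('p) = 2 then \<i> ^ (nat_of a * nat_of b) else 1)"

lemma norm_phase [simp]: "cmod (phase a b) = 1"
  by (simp add: phase_def norm_power)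

lemma phase_nonzero [simp]: "phase a b \<noteq> 0"
  using norm_phase[of a b] by force

lemma opow_Xop: "opow UNIV Xop m r c = (if r = c - of_nat m then 1 else (0::complex))"
  for r c :: "'p mod_ring"
proof (induction m arbitrary: r)
  case 0
  then show ?case by (simp add: opow_def ident_def)
next
  case (Suc m)
  have "opow UNIV Xop (Suc m) r c = (\<Sum>b\<in>UNIV. Xop r b * opow UNIV Xop m b c)"
    by (simp add: opow_def mmul_def)
  also have "\<dots> = (\<Sum>b\<in>UNIV. if b = c - of_nat m then Xop r b else 0)"
    by (intro sum.cong) (auto simp: Suc.IH)
  also have "\<dots> = Xop r (c - of_nat m)" by simp
  finally show ?case by (simp add: Xop_def algebra_simps)
qed

lemma opow_Zop: "opow UNIV (Zop \<omega>) m r c = (if r = c then chi c ^ m else 0)"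
  for r c :: "'p mod_ring"
proof (induction m arbitrary: r)
  case 0
  then show ?case by (simp add: opow_def ident_def)
next
  case (Suc m)
  have "opow UNIV (Zop \<omega>) (Suc m) r c = (\<Sum>b\<in>UNIV. Zop \<omega> r b * opow UNIV (Zop \<omega>) m b c)"
    by (simp add: opow_def mmul_def)
  also have "\<dots> = (\<Sum>b\<in>UNIV. if b = c then Zop \<omega> r b * chi c ^ m else 0)"
    by (intro sum.cong) (auto simp: Suc.IH)
  also have "\<dots> = Zop \<omega> r c * chi c ^ m" by simp
  finally show ?case by (simp add: Zop_def chi_def)
qed

text \<open>Each column has exactly one nonzero entry, so every sum over an intermediate index
  collapses to one term.\<close>

lemma Nsingle_entry:
  "Nsingle \<omega> a b r c = (if r = c - a then phase a b * chi (b * c) else 0)"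
  for r c :: "'p mod_ring"
proof -
  have "mmul UNIV (opow UNIV Xop (nat_of a)) (opow UNIV (Zop \<omega>) (nat_of b)) r c
      = (\<Sum>m\<in>UNIV. if m = c then (if r = m - a then chi c ^ nat_of b else 0) else 0)"
    unfolding mmul_def by (intro sum.cong) (auto simp: opow_Xop opow_Zop)
  also have "\<dots> = (if r = c - a then chi (b * c) else 0)"
    by (simp add: chi_power_nat_of mult.commute)
  finally show ?thesis by (simp add: Nsingle_def phase_def)
qed

text \<open>The scalar by which the product of two Weyl operators differs from the Weyl operator of
  the sum. The factor \<open>chi (- (b * a'))\<close> is the cost of moving \<open>Z^b\<close> to
  the right past \<open>X^a'\<close>; the quotient compares the prefactors of the three
  operators.\<close>

definition cocycle1 :: "'p mod_ring \<Rightarrow> 'p mod_ring \<Rightarrow> 'p mod_ring \<Rightarrow> 'p mod_ring \<Rightarrow> complex" where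
  "cocycle1 a b a' b' = phase a b * phase a' b' / phase (a + a') (b + b') * chi (- (b * a'))"

lemma Nsingle_mult:
  "(\<Sum>m\<in>UNIV. Nsingle \<omega> a b r m * Nsingle \<omega> a' b' m c)
    = cocycle1 a b a' b' * Nsingle \<omega> (a + a') (b + b') r c"
  for r c :: "'p mod_ring"
proof -
  have "(\<Sum>m\<in>UNIV. Nsingle \<omega> a b r m * Nsingle \<omega> a' b' m c)
      = (\<Sum>m\<in>UNIV. if m = c - a' then Nsingle \<omega> a b r m * (phase a' b' * chi (b' * c)) else 0)"
    by (intro sum.cong) (auto simp: Nsingle_entry[of a' b'])
  also have "\<dots> = Nsingle \<omega> a b r (c - a') * (phase a' b' * chi (b' * c))"
    by simp
  also have "\<dots> = cocycle1 a b a' b' * Nsingle \<omega> (a + a') (b + b') r c"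
  proof -
    have "chi (b * (c - a')) = chi (b * c) * chi (- (b * a'))"
      by (simp add: right_diff_distrib flip: chi_add)
    moreover have "chi ((b + b') * c) = chi (b * c) * chi (b' * c)"
      by (simp add: distrib_right chi_add)
    moreover have "r = c - a' - a \<longleftrightarrow> r = c - (a + a')" by (auto simp: algebra_simps)
    ultimately show ?thesis by (simp add: Nsingle_entry cocycle1_def)
  qed
  finally show ?thesis .
qed

lemma Nsingle_unitary:
  "(\<Sum>m\<in>UNIV. cnj (Nsingle \<omega> a b m r) * Nsingle \<omega> a b m c) = (if r = c then 1 else 0)"
  for r c :: "'p mod_ring"
proof -
  have "(\<Sum>m\<in>UNIV. cnj (Nsingle \<omega> a b m r) * Nsingle \<omega> a b m c)
     = (\<Sum>m\<in>UNIV. if m = c - a then cnj (Nsingle \<omega> a b m r) * (phase a b * chi (b * c)) else 0)"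
    by (intro sum.cong) (auto simp: Nsingle_entry[of a b _ c])
  also have "\<dots> = cnj (Nsingle \<omega> a b (c - a) r) * (phase a b * chi (b * c))"
    by simp
  also have "\<dots> = (if r = c then 1 else 0)"
  proof -
    have "cnj (phase a b) * phase a b = 1"
      using complex_norm_square[of "phase a b"] by (simp add: mult.commute)
    moreover have "cnj (phase a b) * cnj (chi (b * c)) * (phase a b * chi (b * c))
        = (cnj (phase a b) * phase a b) * (cnj (chi (b * c)) * chi (b * c))"
      by (simp only: mult_ac)
    ultimately show ?thesis by (simp add: Nsingle_entry)
  qed
  finally show ?thesis .
qed

section \<open>Weyl operators on \<open>n\<close> qudits\<close>

definition cocycle :: "nat \<Rightarrow> 'p mod_ring list \<Rightarrow> 'p mod_ring list \<Rightarrow> complex" where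
  "cocycle n y y' = (\<Prod>i<n. cocycle1 (y ! (2*i)) (y ! (2*i+1)) (y' ! (2*i)) (y' ! (2*i+1)))"

lemma norm_cocycle [simp]: "cmod (cocycle n y y') = 1"
  by (simp add: cocycle_def cocycle1_def norm_mult norm_divide flip: prod_norm)

text \<open>The quotient of prefactors is symmetric in the two arguments and cancels. What remains
  in each coordinate is \<open>chi\<close> of one summand of the symplectic form.\<close>

lemma cocycle_commute: "cocycle n y y' = chi (symp n y y') * cocycle n y' y"
proof -
  have swap: "cocycle1 a b a' b' = chi (a * b' - b * a') * cocycle1 a' b' a b" for a b a' b'
  proof -
    have "chi (- (b * a')) = chi (a * b' - b * a') * chi (- (b' * a))"
      by (simp add: mult.commute flip: chi_add)
    then show ?thesis by (simp add: cocycle1_def add.commute)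
  qed
  show ?thesis
    unfolding cocycle_def symp_def chi_sum prod.distrib[symmetric]
    by (intro prod.cong refl swap)
qed

lemma mmul_Npauli:
  assumes "length y = 2 * n" "length y' = 2 * n"
  shows "mmul (Bn n) (Npauli \<omega> n y) (Npauli \<omega> n y') = (\<lambda>l l'. cocycle n y y' * Npauli \<omega> n (vadd y y') l l')"
proof (intro ext)
  fix l l' :: "'p mod_ring list"
  show "mmul (Bn n) (Npauli \<omega> n y) (Npauli \<omega> n y') l l' = cocycle n y y' * Npauli \<omega> n (vadd y y') l l'"
  proof (cases "length l = n \<and> length l' = n")
    case True
    let ?N = "\<lambda>y i. Nsingle \<omega> (y ! (2*i)) (y ! (2*i+1))"
    have "mmul (Bn n) (Npauli \<omega> n y) (Npauli \<omega> n y') l l'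
        = (\<Sum>m\<in>{m. length m = n}. \<Prod>i<n. ?N y i (l ! i) (m ! i) * ?N y' i (m ! i) (l' ! i))"
      unfolding mmul_def Bn_def using True by (intro sum.cong) (auto simp: Npauli_def prod.distrib)
    also have "\<dots> = (\<Prod>i<n. \<Sum>b\<in>UNIV. ?N y i (l ! i) b * ?N y' i b (l' ! i))"
      by (rule sum_lists_prod)
    also have "\<dots> = cocycle n y y' * (\<Prod>i<n. ?N (vadd y y') i (l ! i) (l' ! i))"
      unfolding Nsingle_mult cocycle_def prod.distrib[symmetric]
      using assms by (intro prod.cong) (auto simp: vadd_def)
    finally show ?thesis using True by (simp add: Npauli_def)
  next
    case False
    then show ?thesis by (auto simp: mmul_def Npauli_def)
  qed
qed

lemma Npauli_unitary:
  fixes y :: "'p mod_ring list"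
  assumes "l \<in> Bn n" "l' \<in> Bn n"
  shows "mmul (Bn n) (adj (Npauli \<omega> n y)) (Npauli \<omega> n y) l l' = ident (Bn n) l l'"
proof -
  let ?N = "\<lambda>i. Nsingle \<omega> (y ! (2*i)) (y ! (2*i+1))"
  have len: "length l = n" "length l' = n" using assms by (auto simp: Bn_def)
  have "mmul (Bn n) (adj (Npauli \<omega> n y)) (Npauli \<omega> n y) l l'
      = (\<Sum>m\<in>{m. length m = n}. \<Prod>i<n. cnj (?N i (m ! i) (l ! i)) * ?N i (m ! i) (l' ! i))"
    unfolding mmul_def Bn_def adj_def using len by (intro sum.cong) (auto simp: Npauli_def prod.distrib)
  also have "\<dots> = (\<Prod>i<n. \<Sum>b\<in>UNIV. cnj (?N i b (l ! i)) * ?N i b (l' ! i))"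
    by (rule sum_lists_prod)
  also have "\<dots> = (\<Prod>i<n. if l ! i = l' ! i then 1 else 0)"
    unfolding Nsingle_unitary ..
  also have "\<dots> = ident (Bn n) l l'"
    using len by (auto simp: ident_def Bn_def list_eq_iff_nth_eq)
  finally show ?thesis .
qed

lemma Npauli_zero: "Npauli \<omega> n (replicate (2 * n) 0) = ident (Bn n :: 'p mod_ring list set)"
proof (intro ext)
  fix l l' :: "'p mod_ring list"
  have 0: "Nsingle \<omega> 0 0 r c = (if r = c then 1 else 0)" for r c :: "'p mod_ring"
    by (simp add: Nsingle_entry phase_def)
  have "Npauli \<omega> n (replicate (2 * n) 0) l l'
      = (if length l = n \<and> length l' = n then \<Prod>i<n. if l ! i = l' ! i then 1 else 0 else 0)"
    by (auto simp: Npauli_def 0 intro!: prod.cong)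
  also have "\<dots> = ident (Bn n) l l'"
    by (auto simp: ident_def Bn_def list_eq_iff_nth_eq)
  finally show "Npauli \<omega> n (replicate (2 * n) 0) l l' = ident (Bn n) l l'" .
qed

lemma mapply_Npauli_Npauli:
  assumes "length y = 2 * n" "length y' = 2 * n"
  shows "mapply (Bn n) (Npauli \<omega> n y) (mapply (Bn n) (Npauli \<omega> n y') v)
    = (\<lambda>a. cocycle n y y' * mapply (Bn n) (Npauli \<omega> n (vadd y y')) v a)"
  by (simp add: mmul_Npauli[OF assms] mapply_scale_op flip: mapply_mmul)

lemma vadd_commute: "vadd u v = vadd v u"
  unfolding vadd_def by (induction u v rule: list_induct2') (auto simp: add.commute)

text \<open>Both orders give a multiple of the same operator for \<open>vadd y y'\<close>, so they
  differ by the ratio of the two cocycles.\<close>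

lemma Npauli_commute:
  assumes "length y = 2 * n" "length y' = 2 * n"
  shows "mapply (Bn n) (Npauli \<omega> n y) (mapply (Bn n) (Npauli \<omega> n y') v)
    = (\<lambda>a. chi (symp n y y') * mapply (Bn n) (Npauli \<omega> n y') (mapply (Bn n) (Npauli \<omega> n y) v) a)"
  unfolding mapply_Npauli_Npauli[OF assms] mapply_Npauli_Npauli[OF assms(2,1)]
  by (subst cocycle_commute) (simp add: vadd_commute mult.assoc)

text \<open>Once the squares are expanded, summing over \<open>c\<close> first applies orthogonality
  of the characters and leaves only the diagonal terms \<open>s = s'\<close>.\<close>

lemma parseval:
  fixes \<tau> :: "'p mod_ring list \<Rightarrow> complex" and m :: nat
  defines "F \<equiv> \<lambda>c. \<Sum>s\<in>{s. length s = m}. cnj (chi (\<Sum>i<m. c ! i * s ! i)) * \<tau> s"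
  shows "(\<Sum>c\<in>{c. length c = m}. (cmod (F c))\<^sup>2)
    = real CARD('p) ^ m * (\<Sum>s\<in>{s. length s = m}. (cmod (\<tau> s))\<^sup>2)"
proof -
  let ?B = "{s :: 'p mod_ring list. length s = m}"
  let ?w = "\<lambda>c s. chi (\<Sum>i<m. c ! i * s ! i)"
  have orth: "(\<Sum>c\<in>?B. cnj (?w c s) * ?w c s') = (if s = s' then of_nat CARD('p) ^ m else 0)"
    if "s \<in> ?B" "s' \<in> ?B" for s s'
  proof -
    have "(\<Sum>c\<in>?B. cnj (?w c s) * ?w c s') = (\<Sum>c\<in>?B. \<Prod>i<m. chi ((s' ! i - s ! i) * c ! i))"
      by (simp add: cnj_chi sum_subtractf algebra_simps flip: chi_add chi_sum)
    also have "\<dots> = (\<Prod>i<m. \<Sum>b\<in>UNIV. chi ((s' ! i - s ! i) * b))"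
      by (rule sum_lists_prod)
    \<comment> \<open>If \<open>s\<close> and \<open>s'\<close> differ in some coordinate, the
      factor there is a sum over a nontrivial character and vanishes; otherwise each of the
      \<open>m\<close> factors is the field size.\<close>
    also have "\<dots> = (if s = s' then of_nat CARD('p) ^ m else 0)"
      unfolding sum_chi using that by (auto simp: list_eq_iff_nth_eq) (metis lessThan_iff)
    finally show ?thesis .
  qed
  have "complex_of_real (\<Sum>c\<in>?B. (cmod (F c))\<^sup>2) = (\<Sum>c\<in>?B. F c * cnj (F c))"
    by (simp add: complex_norm_square flip: of_real_power)
  also have "\<dots> = (\<Sum>c\<in>?B. \<Sum>s\<in>?B. \<Sum>s'\<in>?B. cnj (?w c s) * ?w c s' * (\<tau> s * cnj (\<tau> s')))"
    by (simp add: F_def sum_product mult_ac)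
  also have "\<dots> = (\<Sum>s\<in>?B. \<Sum>s'\<in>?B. (\<Sum>c\<in>?B. cnj (?w c s) * ?w c s') * (\<tau> s * cnj (\<tau> s')))"
    unfolding sum_distrib_right
    by (subst sum.swap, rule sum.cong[OF refl], rule sum.swap)
  also have "\<dots> = (\<Sum>s\<in>?B. \<Sum>s'\<in>?B. if s = s' then of_nat CARD('p) ^ m * (\<tau> s' * cnj (\<tau> s')) else 0)"
    by (intro sum.cong refl) (auto simp: orth)
  also have "\<dots> = (\<Sum>s\<in>?B. of_nat CARD('p) ^ m * (\<tau> s * cnj (\<tau> s)))"
    by (simp add: finite_lists_length)
  also have "\<dots> = complex_of_real (real CARD('p) ^ m * (\<Sum>s\<in>?B. (cmod (\<tau> s))\<^sup>2))"
    by (simp only: sum_distrib_left of_real_sum of_real_mult complex_norm_square) simp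
  finally show ?thesis using of_real_eq_iff by blast
qed

end

section \<open>Logical basis and code spaces\<close>

lemma length_vadd [simp]: "length (vadd u v) = min (length u) (length v)"
  by (simp add: vadd_def)

lemma length_vscale [simp]: "length (vscale c v) = length v"
  by (simp add: vscale_def)

lemma length_lin_comb [simp]: "length (lin_comb m c g r) = m"
  by (simp add: lin_comb_def)

lemma vadd_left_cancel:
  assumes "length u = m" "length v = m" "length w = m"
  shows "vadd u v = vadd u w \<longleftrightarrow> v = w"
  using assms by (auto simp: vadd_def list_eq_iff_nth_eq)

lemma vscale_zero: "vscale 0 v = replicate (length v) 0"
  by (simp add: vscale_def list_eq_iff_nth_eq)

lemma vscale_of_nat_Suc: "vscale (of_nat (Suc m)) v = vadd v (vscale (of_nat m) v)"
  by (simp add: vscale_def vadd_def list_eq_iff_nth_eq distrib_right)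

lemma lin_comb_0: "lin_comb m c g 0 = replicate m 0"
  by (simp add: lin_comb_def list_eq_iff_nth_eq)

lemma lin_comb_Suc:
  assumes "length (g r) = m"
  shows "lin_comb m c g (Suc r) = vadd (lin_comb m c g r) (vscale (c r) (g r))"
  using assms by (simp add: lin_comb_def vadd_def vscale_def list_eq_iff_nth_eq)

text \<open>Over a prime field every scalar is a multiple of 1, so scaling is repeated addition and
  closure under \<open>vadd\<close> suffices.\<close>

lemma lin_comb_induct:
  fixes g :: "nat \<Rightarrow> 'p::prime_card mod_ring list"
  assumes zero: "P (replicate m 0)"
    and add: "\<And>u v. P u \<Longrightarrow> P v \<Longrightarrow> length u = m \<Longrightarrow> length v = m \<Longrightarrow> P (vadd u v)"
    and gen: "\<And>i. i < r \<Longrightarrow> P (g i)" "\<And>i. i < r \<Longrightarrow> length (g i) = m"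
  shows "P (lin_comb m c g r)"
  using gen
proof (induction r)
  case 0
  then show ?case by (simp add: lin_comb_0 zero)
next
  case (Suc r)
  have gr: "P (g r)" "length (g r) = m" using Suc.prems by auto
  have scale: "P (vscale (of_nat j) (g r))" for j
  proof (induction j)
    case 0
    then show ?case using gr zero by (simp add: vscale_zero)
  next
    case (Suc j)
    then show ?case unfolding vscale_of_nat_Suc using gr by (intro add) auto
  qed
  have "P (vscale (c r) (g r))" using scale[of "nat_of (c r)"] by simp
  then show ?case using Suc gr by (subst lin_comb_Suc) (auto intro!: add)
qed

lemma symp_lin_comb:
  "symp n (lin_comb (2 * n) c g r) y = (\<Sum>j<r. c j * symp n (g j) y)"
proof -
  have "symp n (lin_comb (2 * n) c g r) y
      = (\<Sum>i<n. \<Sum>j<r. c j * (g j ! (2*i) * y ! (2*i+1) - g j ! (2*i+1) * y ! (2*i)))"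
    unfolding symp_def
    by (intro sum.cong refl)
       (simp add: lin_comb_def sum_distrib_right sum_distrib_left sum_subtractf algebra_simps)
  also have "\<dots> = (\<Sum>j<r. c j * symp n (g j) y)"
    unfolding symp_def sum_distrib_left by (rule sum.swap)
  finally show ?thesis .
qed

lemma finite_Bn [simp]: "finite (Bn n)"
  by (simp add: Bn_def finite_lists_length)

text \<open>Eigenvalue equations are known only on \<open>S\<close>. This lets such an eigenvalue be
  pulled out in front of a further operator.\<close>

lemma mapply_cong_scale:
  assumes "\<And>a. a \<in> S \<Longrightarrow> u a = c * v a"
  shows "mapply S A u = (\<lambda>a. c * mapply S A v a)"
  using mapply_cong[OF assms] by (simp add: mapply_scale)

section \<open>Kraus maps on rank-one operators and the error weights\<close>

lemma norm_divide_power_squared: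
  "(cmod (z / of_nat m ^ j))\<^sup>2 = (cmod z)\<^sup>2 / real m ^ (2 * j)"
  by (simp only: norm_divide norm_power norm_of_nat power_divide power_even_eq)

text \<open>Conjugating the rank-one operator of \<open>\<phi>\<close> by \<open>K\<close> gives the
  rank-one operator of \<open>K \<phi>\<close>.\<close>

lemma mapply_rank_one_conj:
  "mapply S (mmul S (mmul S K (outer \<phi> \<phi>)) (adj K)) v
    = (\<lambda>a. inner S (mapply S K \<phi>) v * mapply S K \<phi> a)"
proof -
  have "mapply S (outer \<phi> \<phi>) w = (\<lambda>a. inner S \<phi> w * \<phi> a)" for w
    by (simp add: mapply_def outer_def inner_def sum_distrib_left algebra_simps)
  then show ?thesis by (simp add: mapply_mmul mapply_scale inner_mapply_adj)
qed

lemma inner_cp_apply_rank_one: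
  "inner S v (mapply S (cp_apply S Ks (outer \<phi> \<phi>)) v)
    = complex_of_real (\<Sum>K\<leftarrow>Ks. (cmod (inner S v (mapply S K \<phi>)))\<^sup>2)"
proof (induction Ks)
  case Nil
  then show ?case by (simp add: cp_apply_def mapply_def inner_def)
next
  case (Cons K Ks)
  have rank_one: "inner S (mapply S K \<phi>) v * mapply S K \<phi> a
      = mapply S (mmul S (mmul S K (outer \<phi> \<phi>)) (adj K)) v a" for a
    by (simp add: mapply_rank_one_conj)
  have "mapply S (cp_apply S (K # Ks) (outer \<phi> \<phi>)) v
      = (\<lambda>a. inner S (mapply S K \<phi>) v * mapply S K \<phi> a + mapply S (cp_apply S Ks (outer \<phi> \<phi>)) v a)"
    unfolding rank_one by (simp add: cp_apply_def mapply_def distrib_right sum.distrib)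
  then have "inner S v (mapply S (cp_apply S (K # Ks) (outer \<phi> \<phi>)) v)
      = inner S (mapply S K \<phi>) v * inner S v (mapply S K \<phi>)
        + inner S v (mapply S (cp_apply S Ks (outer \<phi> \<phi>)) v)"
    by (simp add: inner_def sum.distrib distrib_left sum_distrib_left mult_ac)
  also have "inner S (mapply S K \<phi>) v * inner S v (mapply S K \<phi>)
      = complex_of_real ((cmod (inner S v (mapply S K \<phi>)))\<^sup>2)"
    by (subst inner_commute) (simp only: complex_norm_square mult.commute)
  finally show ?case using Cons.IH by simp
qed

text \<open>Up to normalization, \<open>Psi\<close> at \<open>x\<close> is the matrix of
  \<open>N x\<close> written as a vector, and applying \<open>id_tensor A\<close> to
  \<open>Psi\<close> at zero gives the matrix of \<open>A\<close> in the same way. Their inner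
  product is thus the Hilbert-Schmidt product divided by \<open>d ^ n\<close>, and squaring doubles
  the exponent.\<close>

lemma (in primitive_root) P_err_eq:
  fixes x :: "'p mod_ring list"
  shows "P_err \<omega> n As x = complex_of_real
    (\<Sum>A\<leftarrow>As. (cmod (trace (Bn n) (mmul (Bn n) (adj (Npauli \<omega> n x)) A)))\<^sup>2 / real CARD('p) ^ (2 * n))"
proof -
  let ?S = "Bn n :: 'p mod_ring list set"
  define c where "c = complex_of_real (real CARD('p) powr (- real n / 2))"
  let ?\<Psi> = "Psi \<omega> n :: 'p mod_ring list \<Rightarrow> _"
  have c2: "c * c = 1 / of_nat CARD('p) ^ n"
  proof -
    have "c * c = complex_of_real (real CARD('p) powr (- real n / 2 + - real n / 2))"
      by (simp only: c_def powr_add of_real_mult)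
    also have "- real n / 2 + - real n / 2 = - real n" by simp
    also have "real CARD('p) powr (- real n) = 1 / real CARD('p) ^ n"
      by (subst powr_minus) (simp add: powr_realpow divide_inverse)
    finally show ?thesis by simp
  qed
  have Psi_entry: "?\<Psi> y (a, b) = c * Npauli \<omega> n y b a" if "a \<in> ?S" for y a b
    using that by (simp add: Psi_def c_def)
  \<comment> \<open>The reference state contains only the diagonal kets, so the first tensor factor
    selects the column of \<open>A\<close>; this transposes the two indices.\<close>
  have app: "mapply (?S \<times> ?S) (id_tensor A) (?\<Psi> (replicate (2 * n) 0)) (a, b) = c * A b a"
    if "a \<in> ?S" "b \<in> ?S" for A a b
  proof -
    have "mapply (?S \<times> ?S) (id_tensor A) (?\<Psi> (replicate (2 * n) 0)) (a, b)
        = (\<Sum>a'\<in>?S. \<Sum>b'\<in>?S. (if a = a' then 1 else 0) * A b b' * (c * ident ?S b' a'))"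
      by (simp add: mapply_def id_tensor_def Psi_entry Npauli_zero sum.cartesian_product')
    also have "\<dots> = (\<Sum>a'\<in>?S. \<Sum>b'\<in>?S. if b' = a' then (if a = b' then c * A b b' else 0) else 0)"
      by (intro sum.cong) (auto simp: ident_def)
    also have "\<dots> = c * A b a" using that by simp
    finally show ?thesis .
  qed
  have "inner (?S \<times> ?S) (?\<Psi> x) (mapply (?S \<times> ?S) (id_tensor A) (?\<Psi> (replicate (2 * n) 0)))
      = trace ?S (mmul ?S (adj (Npauli \<omega> n x)) A) / of_nat CARD('p) ^ n" for A
  proof -
    have "inner (?S \<times> ?S) (?\<Psi> x) (mapply (?S \<times> ?S) (id_tensor A) (?\<Psi> (replicate (2 * n) 0)))
        = (\<Sum>a\<in>?S. \<Sum>b\<in>?S. cnj (?\<Psi> x (a, b)) * mapply (?S \<times> ?S) (id_tensor A) (?\<Psi> (replicate (2 * n) 0)) (a, b))"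
      by (simp add: inner_def sum.cartesian_product')
    also have "\<dots> = (\<Sum>a\<in>?S. \<Sum>b\<in>?S. (c * c) * (cnj (Npauli \<omega> n x b a) * A b a))"
      by (intro sum.cong refl) (simp add: app Psi_entry c_def)
    also have "\<dots> = trace ?S (mmul ?S (adj (Npauli \<omega> n x)) A) / of_nat CARD('p) ^ n"
      unfolding c2 by (simp add: trace_def mmul_def adj_def sum_divide_distrib)
    finally show ?thesis .
  qed
  then show ?thesis
    unfolding P_err_def Let_def id_tensor_cp_def inner_cp_apply_rank_one
    by (simp add: o_def norm_divide_power_squared)
qed

section \<open>The logical kets as an orthonormal eigenbasis\<close>

locale hyperbolic_frame = primitive_root \<omega> ty
  for \<omega> :: complex and ty :: "'p::prime_card itself" +
  fixes n :: nat and g h :: "nat \<Rightarrow> 'p mod_ring list" and v0 :: "'p mod_ring list vec"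
  assumes len: "\<And>i. i < n \<Longrightarrow> length (g i) = 2 * n" "\<And>i. i < n \<Longrightarrow> length (h i) = 2 * n"
    and symp_gh: "\<And>i j. i < n \<Longrightarrow> j < n \<Longrightarrow> symp n (g i) (h j) = (if i = j then 1 else 0)"
    and v0_unit: "inner (Bn n) v0 v0 = 1"
    and v0_stab: "\<And>i a. i < n \<Longrightarrow> a \<in> Bn n \<Longrightarrow> mapply (Bn n) (Npauli \<omega> n (g i)) v0 a = v0 a"
begin

abbreviation N :: "'p mod_ring list \<Rightarrow> 'p mod_ring list vec \<Rightarrow> 'p mod_ring list vec" where
  "N y \<equiv> mapply (Bn n) (Npauli \<omega> n y)"

abbreviation ket :: "'p mod_ring list \<Rightarrow> 'p mod_ring list vec" where
  "ket \<equiv> logical_ket \<omega> n h v0"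

lemma inner_N: "inner (Bn n) (N y u) (N y v) = inner (Bn n) u v"
  by (rule inner_mapply_unitary[OF finite_Bn Npauli_unitary])

lemma inner_opow:
  fixes y :: "'p mod_ring list"
  shows
  "inner (Bn n) (mapply (Bn n) (opow (Bn n) (Npauli \<omega> n y) m) u)
     (mapply (Bn n) (opow (Bn n) (Npauli \<omega> n y) m) v) = inner (Bn n) u v"
proof (induction m)
  case 0
  then show ?case by (auto simp: opow_def mapply_ident intro: inner_cong)
next
  case (Suc m)
  then show ?case by (simp add: opow_def mapply_mmul inner_N)
qed

text \<open>Each of the \<open>m\<close> exchanges costs one factor \<open>chi (symp n y z)\<close>.
  The equation is restricted to \<open>Bn n\<close> because the zeroth power is
  \<open>ident (Bn n)\<close>, which vanishes elsewhere.\<close>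

lemma N_opow_commute:
  assumes "length y = 2 * n" "length z = 2 * n" "a \<in> Bn n"
  shows "N y (mapply (Bn n) (opow (Bn n) (Npauli \<omega> n z) m) v) a
    = chi (symp n y z) ^ m * mapply (Bn n) (opow (Bn n) (Npauli \<omega> n z) m) (N y v) a"
  using assms(3)
proof (induction m arbitrary: a)
  case 0
  have "N y (mapply (Bn n) (ident (Bn n)) v) = N y v"
    by (rule mapply_cong) (simp add: mapply_ident)
  then show ?case using 0 by (simp add: opow_def mapply_ident)
next
  case (Suc m)
  let ?K = "\<lambda>m. opow (Bn n) (Npauli \<omega> n z) m"
  have K: "mapply (Bn n) (?K (Suc m)) w = N z (mapply (Bn n) (?K m) w)" for w
    by (simp add: opow_def mapply_mmul)
  have "N y (mapply (Bn n) (?K (Suc m)) v) a = chi (symp n y z) * N z (N y (mapply (Bn n) (?K m) v)) a"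
    unfolding K using Npauli_commute[OF assms(1,2)] by simp
  also have "N z (N y (mapply (Bn n) (?K m) v))
      = (\<lambda>a. chi (symp n y z) ^ m * N z (mapply (Bn n) (?K m) (N y v)) a)"
    by (rule mapply_cong_scale) (rule Suc.IH)
  finally show ?case by (simp add: K)
qed

lemma norm_ket: "inner (Bn n) (ket l) (ket l) = 1"
proof -
  \<comment> \<open>An arbitrary list of isometries is what the induction needs; the list
    \<open>[0..<n]\<close> is put in afterwards.\<close>
  have *: "inner (Bn n) (foldr f xs v0) (foldr f xs v0) = 1"
    if "\<And>i u v. inner (Bn n) (f i u) (f i v) = inner (Bn n) u v" for f :: "nat \<Rightarrow> _" and xs
    by (induction xs) (auto simp: that v0_unit)
  show ?thesis unfolding logical_ket_def by (intro * inner_opow)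
qed

text \<open>The eigenvalue is kept as a parameter: a product of the \<open>N\<close> of several
  \<open>g i\<close> fixes \<open>v0\<close>, but equals the \<open>N\<close> of the sum only up to
  a cocycle.\<close>

definition stabilizes :: "'p mod_ring list \<Rightarrow> complex \<Rightarrow> bool" where
  "stabilizes y \<nu> \<longleftrightarrow> length y = 2 * n \<and> cmod \<nu> = 1 \<and> (\<forall>a\<in>Bn n. N y v0 a = \<nu> * v0 a)"

text \<open>Moving \<open>N y\<close> through the powers of the \<open>N\<close> of each
  \<open>h i\<close> contributes one character value per \<open>i\<close>; at the end it meets
  \<open>v0\<close> and yields \<open>\<nu>\<close>.\<close>

lemma N_ket:
  assumes "stabilizes y \<nu>" "a \<in> Bn n"
  shows "N y (ket l) a = \<nu> * chi (\<Sum>i<n. symp n y (h i) * l ! i) * ket l a"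
proof -
  let ?f = "\<lambda>i w. mapply (Bn n) (opow (Bn n) (Npauli \<omega> n (h i)) (nat_of (l ! i))) w"
  have "N y (foldr ?f xs v0) a = \<nu> * chi (\<Sum>i\<leftarrow>xs. symp n y (h i) * l ! i) * foldr ?f xs v0 a"
    if "set xs \<subseteq> {..<n}" "a \<in> Bn n" for xs a
    using that
  proof (induction xs arbitrary: a)
    case Nil
    then show ?case using assms by (simp add: stabilizes_def)
  next
    case (Cons i xs)
    let ?c = "\<nu> * chi (\<Sum>i\<leftarrow>xs. symp n y (h i) * l ! i)"
    have "N y (foldr ?f (i # xs) v0) a
        = chi (symp n y (h i)) ^ nat_of (l ! i) * ?f i (N y (foldr ?f xs v0)) a"
      using Cons.prems assms len by (simp add: N_opow_commute stabilizes_def)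
    also have "?f i (N y (foldr ?f xs v0)) = (\<lambda>a. ?c * ?f i (foldr ?f xs v0) a)"
      using Cons by (intro mapply_cong_scale) auto
    finally show ?case by (simp add: chi_power_nat_of chi_add mult_ac)
  qed
  from this[of "[0..<n]" a] show ?thesis
    unfolding logical_ket_def interv_sum_list_conv_sum_set_nat
    using assms by (auto simp: atLeast0LessThan)
qed

lemma stabilizes_g: "i < n \<Longrightarrow> stabilizes (g i) 1"
  by (simp add: stabilizes_def len v0_stab)

text \<open>Since \<open>g\<close> and \<open>h\<close> are dual under the symplectic form, the
  eigenvalues on \<open>ket l\<close> encode exactly the entries of \<open>l\<close>.\<close>

lemma N_g_ket:
  assumes "i < n" "a \<in> Bn n"
  shows "N (g i) (ket l) a = chi (l ! i) * ket l a"
proof -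
  have "(\<Sum>j<n. symp n (g i) (h j) * l ! j) = (\<Sum>j<n. if i = j then l ! j else 0)"
    using assms by (intro sum.cong) (auto simp: symp_gh)
  also have "\<dots> = l ! i" using assms by simp
  finally show ?thesis using N_ket[OF stabilizes_g[OF assms(1)] assms(2)] by simp
qed

text \<open>Stabilizing vectors are closed under addition: the two eigenvalues multiply, and the
  product is divided by the cocycle, which also has modulus one.\<close>

lemma stabilizes_lin_comb:
  assumes "r \<le> n"
  shows "\<exists>\<nu>. stabilizes (lin_comb (2 * n) c g r) \<nu>"
proof (rule lin_comb_induct[where P = "\<lambda>y. \<exists>\<nu>. stabilizes y \<nu>"])
  show "\<exists>\<nu>. stabilizes (replicate (2 * n) 0) \<nu>"
    by (rule exI[of _ 1]) (simp add: stabilizes_def Npauli_zero mapply_ident)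
next
  fix u v :: "'p mod_ring list"
  assume "\<exists>\<nu>. stabilizes u \<nu>" "\<exists>\<nu>. stabilizes v \<nu>" and l: "length u = 2 * n" "length v = 2 * n"
  then obtain \<nu> \<mu> where st: "stabilizes u \<nu>" "stabilizes v \<mu>" by blast
  have "N u (N v v0) = (\<lambda>a. \<mu> * N u v0 a)"
    using st by (intro mapply_cong_scale) (simp add: stabilizes_def)
  then have "cocycle n u v * N (vadd u v) v0 a = \<mu> * N u v0 a" for a
    unfolding mapply_Npauli_Npauli[OF l] by (rule fun_cong)
  moreover have "cocycle n u v \<noteq> 0" using norm_cocycle[of n u v] by force
  ultimately have "stabilizes (vadd u v) (\<nu> * \<mu> / cocycle n u v)"
    using st l by (auto simp: stabilizes_def norm_mult norm_divide field_simps)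
  then show "\<exists>\<nu>. stabilizes (vadd u v) \<nu>" by blast
qed (use assms len in \<open>auto intro!: exI[of _ 1] stabilizes_g\<close>)

text \<open>Unitarity of \<open>N y\<close> shows that the inner product equals
  \<open>chi (\<beta> - \<alpha>)\<close> times itself.\<close>

lemma inner_eq_0_of_eigenvalues:
  assumes "\<And>a. a \<in> Bn n \<Longrightarrow> N y u a = chi \<alpha> * u a" "\<And>a. a \<in> Bn n \<Longrightarrow> N y v a = chi \<beta> * v a"
    and "\<alpha> \<noteq> \<beta>"
  shows "inner (Bn n) u v = 0"
proof -
  have "inner (Bn n) u v = inner (Bn n) (\<lambda>a. chi \<alpha> * u a) (\<lambda>a. chi \<beta> * v a)"
    unfolding inner_N[of y u v, symmetric] using assms by (intro inner_cong)
  also have "\<dots> = chi (\<beta> - \<alpha>) * inner (Bn n) u v"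
    by (simp add: inner_scale_left inner_scale_right cnj_chi flip: chi_add)
  finally show ?thesis using \<open>\<alpha> \<noteq> \<beta>\<close> chi_eq_1_iff[of "\<beta> - \<alpha>"] by auto
qed

text \<open>Distinct labels differ in some entry \<open>i\<close>, where the \<open>N\<close> of
  \<open>g i\<close> separates the kets. Labels and coordinates both range over \<open>Bn n\<close>,
  so the family has the right cardinality to be a basis.\<close>

lemma orthonormal_kets: "orthonormal_on (Bn n) (Bn n) ket"
  unfolding orthonormal_on_def
proof (intro ballI)
  fix l l' :: "'p mod_ring list" assume l: "l \<in> Bn n" "l' \<in> Bn n"
  show "inner (Bn n) (ket l) (ket l') = (if l = l' then 1 else 0)"
  proof (cases "l = l'")
    case False
    then obtain i where "i < n" "l ! i \<noteq> l' ! i"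
      using l by (auto simp: Bn_def list_eq_iff_nth_eq)
    then show ?thesis using False N_g_ket inner_eq_0_of_eigenvalues by metis
  qed (simp add: norm_ket)
qed

section \<open>Code projections, recovery traces and traces over a coset\<close>

context
  fixes k :: nat
  assumes k_le: "k \<le> n"
begin

lemma code_proj_eq:
  assumes "length s = n - k"
  shows "code_proj \<omega> n k h v0 s = onb_proj (Bn n) {u. length u = k} (\<lambda>u. ket (s @ u))"
  unfolding code_proj_def
proof (rule orth_proj_cspan_orthonormal)
  show "orthonormal_on (Bn n) {u. length u = k} (\<lambda>u. ket (s @ u))"
    using orthonormal_kets assms k_le by (auto simp: orthonormal_on_def Bn_def)
qed (auto simp: finite_lists_length)

text \<open>\<open>N x\<close> shifts the eigenvalue label from \<open>s\<close> to
  \<open>vadd t s\<close>. In the logical expansion of the image only kets with that prefix survive,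
  and those span the code space projected onto.\<close>

lemma code_proj_N_ket:
  assumes len': "length x = 2 * n" "length s = n - k" "length t = n - k" "length u = k"
    and syndrome: "\<And>i. i < n - k \<Longrightarrow> symp n (g i) x = t ! i" and a: "a \<in> Bn n"
  shows "mapply (Bn n) (code_proj \<omega> n k h v0 (vadd t s)) (N x (ket (s @ u))) a = N x (ket (s @ u)) a"
proof -
  let ?w = "N x (ket (s @ u))"
  have zero: "inner (Bn n) (ket (s' @ u')) ?w = 0"
    if s': "length s' = n - k" "s' \<noteq> vadd t s" for s' u'
  proof -
    from s' len' obtain i where i: "i < n - k" "s' ! i \<noteq> t ! i + s ! i"
      by (auto simp: list_eq_iff_nth_eq vadd_def)
    have left: "N (g i) (ket (s' @ u')) a = chi (s' ! i) * ket (s' @ u') a" if "a \<in> Bn n" for a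
      using N_g_ket[of i a "s' @ u'"] that i s' by (simp add: nth_append)
    \<comment> \<open>Exchanging the \<open>N\<close> of \<open>g i\<close> with \<open>N x\<close>
      contributes the syndrome value \<open>chi (t ! i)\<close> on top of the eigenvalue
      \<open>chi (s ! i)\<close> of the ket.\<close>
    have right: "N (g i) ?w a = chi (t ! i + s ! i) * ?w a" if "a \<in> Bn n" for a
    proof -
      have "N x (N (g i) (ket (s @ u))) = (\<lambda>a. chi (s ! i) * ?w a)"
        using N_g_ket[of i _ "s @ u"] i len' by (intro mapply_cong_scale) (simp add: nth_append)
      then show ?thesis
        using Npauli_commute[of "g i" n x "ket (s @ u)"] i len' len syndrome[OF i(1)]
        by (simp add: chi_add)
    qed
    show ?thesis by (rule inner_eq_0_of_eigenvalues[OF left right i(2)])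
  qed
  have "?w a = (\<Sum>l\<in>Bn n. inner (Bn n) (ket l) ?w * ket l a)"
    using orthonormal_expansion[OF finite_Bn finite_Bn refl orthonormal_kets a] by simp
  also have "\<dots> = (\<Sum>s'\<in>{s'. length s' = n - k}. \<Sum>u'\<in>{u'. length u' = k}.
      inner (Bn n) (ket (s' @ u')) ?w * ket (s' @ u') a)"
    using sum_lists_append[where m = "n - k" and k = k and f = "\<lambda>l. inner (Bn n) (ket l) ?w * ket l a"] k_le
    by (simp add: Bn_def)
  also have "\<dots> = (\<Sum>s'\<in>{s'. length s' = n - k}. if s' = vadd t s then
      (\<Sum>u'\<in>{u'. length u' = k}. inner (Bn n) (ket (s' @ u')) ?w * ket (s' @ u') a) else 0)"
    by (intro sum.cong) (auto simp: zero)
  also have "\<dots> = (\<Sum>u'\<in>{u'. length u' = k}.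
      inner (Bn n) (ket (vadd t s @ u')) ?w * ket (vadd t s @ u') a)"
    using len' by (simp add: finite_lists_length)
  finally show ?thesis
    using len' a by (simp add: code_proj_eq mapply_onb_proj)
qed

definition overlap :: "'p mod_ring list \<Rightarrow> 'p mod_ring list op \<Rightarrow> 'p mod_ring list \<Rightarrow> complex" where
  "overlap x A s = (\<Sum>u\<in>{u. length u = k}.
     inner (Bn n) (N x (ket (s @ u))) (mapply (Bn n) A (ket (s @ u))))"

text \<open>The trace against the code projection is a sum of diagonal elements over kets with
  prefix \<open>s\<close>. In each, \<open>N x\<close> and the self-adjoint recovery projection move
  to the left argument, where the projection acts trivially.\<close>

lemma trace_recovery:
  assumes "length x = 2 * n" "length s = n - k" "length t = n - k"
    and "\<And>i. i < n - k \<Longrightarrow> symp n (g i) x = t ! i"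
  shows "trace (Bn n) (mmul (Bn n) (\<lambda>a b. code_proj \<omega> n k h v0 s a b / c)
      (mmul (Bn n) (mmul (Bn n) (adj (Npauli \<omega> n x)) (code_proj \<omega> n k h v0 (vadd t s))) A))
    = overlap x A s / c"
proof -
  let ?P = "code_proj \<omega> n k h v0"
  let ?B = "mmul (Bn n) (mmul (Bn n) (adj (Npauli \<omega> n x)) (?P (vadd t s))) A"
  have adj_P: "adj (?P (vadd t s)) = ?P (vadd t s)"
    using assms by (simp add: code_proj_eq adj_onb_proj)
  have "inner (Bn n) (ket (s @ u)) (mapply (Bn n) ?B (ket (s @ u)))
      = inner (Bn n) (N x (ket (s @ u))) (mapply (Bn n) A (ket (s @ u)))" if "length u = k" for u
  proof -
    let ?w = "mapply (Bn n) A (ket (s @ u))"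
    have "inner (Bn n) (ket (s @ u)) (mapply (Bn n) ?B (ket (s @ u)))
        = inner (Bn n) (N x (ket (s @ u))) (mapply (Bn n) (adj (?P (vadd t s))) ?w)"
      unfolding mapply_mmul inner_mapply_adj adj_P ..
    also have "\<dots> = inner (Bn n) (N x (ket (s @ u))) ?w"
      unfolding inner_mapply_adj using assms that
      by (intro inner_cong refl) (rule code_proj_N_ket)
    finally show ?thesis .
  qed
  then have "trace (Bn n) (mmul (Bn n) (?P s) ?B) = overlap x A s"
    using assms(2) by (simp add: code_proj_eq trace_mmul_onb_proj overlap_def)
  moreover have "trace (Bn n) (mmul (Bn n) (\<lambda>a b. ?P s a b / c) ?B) = trace (Bn n) (mmul (Bn n) (?P s) ?B) / c"
    by (simp add: trace_def mmul_def sum_divide_distrib)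
  ultimately show ?thesis by simp
qed

lemma ent_fid_recovery:
  assumes "length (xhat t) = 2 * n" "length s = n - k" "length t = n - k"
    and "\<And>i. i < n - k \<Longrightarrow> symp n (g i) (xhat t) = t ! i"
  shows "ent_fid (Bn n) (\<lambda>a b. code_proj \<omega> n k h v0 s a b / of_nat (CARD('p) ^ k))
      (cp_comp (Bn n) [recovery_op \<omega> n k h v0 xhat s t] As)
    = (\<Sum>A\<leftarrow>As. (cmod (overlap (xhat t) A s))\<^sup>2 / real CARD('p) ^ (2 * k))"
proof -
  let ?R = "recovery_op \<omega> n k h v0 xhat s t"
  have "trace (Bn n) (mmul (Bn n) (\<lambda>a b. code_proj \<omega> n k h v0 s a b / of_nat (CARD('p) ^ k))
      (mmul (Bn n) ?R A)) = overlap (xhat t) A s / of_nat CARD('p) ^ k" for A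
    unfolding recovery_op_def of_nat_power by (rule trace_recovery) (use assms in auto)
  moreover have "cp_comp (Bn n) [?R] As = map (mmul (Bn n) ?R) As"
    by (simp add: cp_comp_def)
  ultimately show ?thesis by (simp only: ent_fid_def map_map o_def norm_divide_power_squared)
qed

text \<open>On a ket with prefix \<open>s\<close>, the element of \<open>L\<close> with coefficients
  \<open>c\<close> acts as a character value in \<open>s\<close> times a scalar common to all kets.
  The trace in the logical basis is therefore a Fourier coefficient of \<open>overlap\<close>, and
  the modulus removes the common scalar.\<close>

lemma norm_trace_Npauli_coset:
  assumes "length x = 2 * n" "length c = n - k"
  shows "cmod (trace (Bn n) (mmul (Bn n) (adj (Npauli \<omega> n (vadd x (lin_comb (2 * n) ((!) c) g (n - k))))) A))
    = cmod (\<Sum>s\<in>{s. length s = n - k}. cnj (chi (\<Sum>i<n-k. c ! i * s ! i)) * overlap x A s)"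
proof -
  let ?y = "lin_comb (2 * n) ((!) c) g (n - k)"
  obtain \<nu> where \<nu>: "stabilizes ?y \<nu>" using stabilizes_lin_comb[of "n - k"] by auto
  \<comment> \<open>This phase combines the eigenvalue of \<open>?y\<close> on \<open>v0\<close>
    with the cocycle from splitting the \<open>N\<close> of \<open>vadd x ?y\<close> into a
    product.\<close>
  define \<kappa> where "\<kappa> = \<nu> / cocycle n x ?y"
  have coc: "cocycle n x ?y \<noteq> 0" using norm_cocycle[of n x ?y] by force
  have \<kappa>: "cmod \<kappa> = 1" using \<nu> by (simp add: \<kappa>_def stabilizes_def norm_divide)
  have symp_y: "symp n ?y (h i) = (if i < n - k then c ! i else 0)" if "i < n" for i
  proof -
    have "symp n ?y (h i) = (\<Sum>j<n-k. if i = j then c ! j else 0)"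
      unfolding symp_lin_comb using that by (intro sum.cong) (auto simp: symp_gh)
    then show ?thesis by simp
  qed
  \<comment> \<open>Only the first \<open>n - k\<close> vectors of \<open>g\<close> occur in
    \<open>?y\<close>, so the pairing with the later \<open>h i\<close> vanishes and
    \<open>u\<close> drops out.\<close>
  have exponent: "(\<Sum>i<n. symp n ?y (h i) * (s @ u) ! i) = (\<Sum>i<n-k. c ! i * s ! i)"
    if "length s = n - k" for s u
  proof -
    have "(\<Sum>i<n. symp n ?y (h i) * (s @ u) ! i) = (\<Sum>i<n. if i < n - k then c ! i * s ! i else 0)"
      using that by (intro sum.cong) (auto simp: symp_y nth_append)
    also have "\<dots> = (\<Sum>i\<in>{..<n} \<inter> {i. i < n - k}. c ! i * s ! i)"
      by (simp add: sum.If_cases)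
    also have "{..<n} \<inter> {i. i < n - k} = {..<n-k}" by auto
    finally show ?thesis .
  qed
  have N_coset: "N (vadd x ?y) (ket (s @ u)) = (\<lambda>a. \<kappa> * chi (\<Sum>i<n-k. c ! i * s ! i) * N x (ket (s @ u)) a)"
    if "length s = n - k" for s u
  proof -
    have "N x (N ?y (ket (s @ u))) = (\<lambda>a. \<nu> * chi (\<Sum>i<n-k. c ! i * s ! i) * N x (ket (s @ u)) a)"
      using N_ket[OF \<nu>] exponent[OF that] by (intro mapply_cong_scale) simp
    then have "cocycle n x ?y * N (vadd x ?y) (ket (s @ u)) a
        = \<nu> * chi (\<Sum>i<n-k. c ! i * s ! i) * N x (ket (s @ u)) a" for a
      using mapply_Npauli_Npauli[OF assms(1) length_lin_comb] by metis
    then show ?thesis using coc by (auto simp: \<kappa>_def field_simps)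
  qed
  have "trace (Bn n) (mmul (Bn n) (adj (Npauli \<omega> n (vadd x ?y))) A)
      = (\<Sum>l\<in>Bn n. inner (Bn n) (N (vadd x ?y) (ket l)) (mapply (Bn n) A (ket l)))"
    unfolding trace_onb[OF finite_Bn finite_Bn refl orthonormal_kets] mapply_mmul inner_mapply_adj ..
  also have "\<dots> = (\<Sum>s\<in>{s. length s = n - k}. \<Sum>u\<in>{u. length u = k}.
      inner (Bn n) (N (vadd x ?y) (ket (s @ u))) (mapply (Bn n) A (ket (s @ u))))"
    using sum_lists_append[where m = "n - k" and k = k and
        f = "\<lambda>l. inner (Bn n) (N (vadd x ?y) (ket l)) (mapply (Bn n) A (ket l))"] k_le
    by (simp add: Bn_def)
  also have "\<dots> = cnj \<kappa> * (\<Sum>s\<in>{s. length s = n - k}. cnj (chi (\<Sum>i<n-k. c ! i * s ! i)) * overlap x A s)"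
    unfolding sum_distrib_left overlap_def
    by (intro sum.cong refl) (simp add: N_coset inner_scale_left mult.assoc)
  finally show ?thesis using \<kappa> by (simp add: norm_mult)
qed

lemma sum_norm_trace_coset:
  assumes "length x = 2 * n"
  shows "(\<Sum>c\<in>{c. length c = n - k}. (cmod (trace (Bn n) (mmul (Bn n)
      (adj (Npauli \<omega> n (vadd x (lin_comb (2 * n) ((!) c) g (n - k))))) A)))\<^sup>2)
    = real CARD('p) ^ (n - k) * (\<Sum>s\<in>{s. length s = n - k}. (cmod (overlap x A s))\<^sup>2)"
  unfolding parseval[symmetric] using assms by (intro sum.cong) (auto simp: norm_trace_Npauli_coset)

text \<open>Pairing with \<open>h i\<close> reads off the coefficient of \<open>g i\<close>.\<close>

lemma lin_comb_inject:
  assumes "length c = n - k" "length c' = n - k"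
    and "lin_comb (2 * n) ((!) c) g (n - k) = lin_comb (2 * n) ((!) c') g (n - k)"
  shows "c = c'"
proof (rule nth_equalityI)
  fix i assume "i < length c"
  then have i: "i < n - k" using assms by simp
  have "symp n (lin_comb (2 * n) ((!) d) g (n - k)) (h i) = d ! i" for d :: "'p mod_ring list"
  proof -
    have "symp n (lin_comb (2 * n) ((!) d) g (n - k)) (h i) = (\<Sum>j<n-k. if i = j then d ! j else 0)"
      unfolding symp_lin_comb using i by (intro sum.cong) (auto simp: symp_gh)
    then show ?thesis using i by simp
  qed
  then show "c ! i = c' ! i" using assms(3) by metis
qed (use assms in simp)

end

end

section \<open>From code fidelities to the sum over the coset\<close>

lemma subspace_lin_comb_mem:
  assumes "subspace_Fd m L" "\<And>i. i < r \<Longrightarrow> g i \<in> L"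
  shows "lin_comb m c g r \<in> L"
  using assms by (intro lin_comb_induct[where P = "\<lambda>v. v \<in> L"]) (auto simp: subspace_Fd_def)

lemma sum_list_sum: "(\<Sum>x\<in>X. \<Sum>A\<leftarrow>As. f x A) = (\<Sum>A\<leftarrow>As. \<Sum>x\<in>X. f x A)"
  for f :: "'a \<Rightarrow> 'b \<Rightarrow> real"
  by (induction As) (auto simp: sum.distrib)

theorem theorem1:
  fixes \<omega> :: complex
    and n k :: nat
    and L :: "'p::prime_card mod_ring list set"
    and g h :: "nat \<Rightarrow> 'p mod_ring list"
    and v0 :: "'p mod_ring list vec"
    and xhat :: "'p mod_ring list \<Rightarrow> 'p mod_ring list"
    and t :: "'p mod_ring list"
    and As :: "'p mod_ring list op list"
  assumes omega_prim: "\<omega> ^ CARD('p) = 1" "\<forall>m. 0 < m \<and> m < CARD('p) \<longrightarrow> \<omega> ^ m \<noteq> 1"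
    and n_pos: "1 \<le> n" and k_le: "k \<le> n"
    and L_sub: "subspace_Fd (2*n) L"
    and L_iso: "L \<subseteq> symp_perp n L"
    and L_dim: "dim_Fd (2*n) L (n - k)"
    and hyp: "hyperbolic_adapted n k L g h"
    and v0_unit: "inner (Bn n) v0 v0 = 1"
    and v0_stab: "\<forall>i<n. \<forall>a\<in>Bn n. mapply (Bn n) (Npauli \<omega> n (g i)) v0 a = v0 a"
    and xhat: "\<forall>t'. length t' = n - k \<longrightarrow>
                 length (xhat t') = 2*n \<and> (\<forall>i<n-k. symp n (g i) (xhat t') = t' ! i)"
    and t_len: "length t = n - k"
    and As_ops: "\<forall>A\<in>set As. op_on (Bn n) A"
    and As_tp: "trace_preserving (Bn n) As"
  shows "(1 / real CARD('p) ^ (n - k)) *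
           (\<Sum>s\<in>{s. length s = n - k}.
              ent_fid (Bn n)
                (\<lambda>a b. code_proj \<omega> n k h v0 s a b / of_nat (CARD('p) ^ k))
                (cp_comp (Bn n) [recovery_op \<omega> n k h v0 xhat s t] As))
         = (\<Sum>x\<in>{vadd (xhat t) y | y. y \<in> L}. P_err \<omega> n As x)"
proof -
  interpret hyperbolic_frame \<omega> "TYPE('p)" n g h v0
    using omega_prim hyp v0_unit v0_stab
    by unfold_locales (auto simp: hyperbolic_adapted_def)
  let ?d = "real CARD('p)" and ?B = "{s :: 'p mod_ring list. length s = n - k}"
  let ?y = "\<lambda>c. lin_comb (2 * n) ((!) c) g (n - k)"
  define x where "x = xhat t"
  have x: "length x = 2 * n" "\<And>i. i < n - k \<Longrightarrow> symp n (g i) x = t ! i"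
    using xhat t_len by (auto simp: x_def)
  have basis: "\<And>i. i < n - k \<Longrightarrow> g i \<in> L" "\<And>v. v \<in> L \<Longrightarrow> \<exists>c. v = lin_comb (2 * n) c g (n - k)"
    using hyp by (auto simp: hyperbolic_adapted_def is_basis_def)
  have "L = ?y ` ?B"
  proof (intro equalityI subsetI)
    fix v assume "v \<in> L"
    then obtain c where "v = lin_comb (2 * n) c g (n - k)" using basis(2) by blast
    \<comment> \<open>Coefficient functions are not unique beyond \<open>n - k\<close>; lists of
      that length label the elements of \<open>L\<close> bijectively.\<close>
    then have "v = ?y (map c [0..<n-k])" by (simp add: lin_comb_def)
    then show "v \<in> ?y ` ?B" by (intro image_eqI[of _ _ "map c [0..<n-k]"]) auto
  qed (auto intro: subspace_lin_comb_mem[OF L_sub basis(1)])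
  then have coset: "{vadd x y | y. y \<in> L} = (\<lambda>c. vadd x (?y c)) ` ?B" by auto
  \<comment> \<open>The theorem sums over a set of vectors, so injectivity ensures that reindexing
    by coefficient lists counts each vector once.\<close>
  have inj: "inj_on (\<lambda>c. vadd x (?y c)) ?B"
    using x lin_comb_inject[OF k_le] by (auto simp: inj_on_def vadd_left_cancel[of _ "2 * n"])
  \<comment> \<open>Both sides are multiples of \<open>q\<close>: the fidelities sum to
    \<open>q / ?d ^ (2 * k)\<close>, and Parseval gives
    \<open>?d ^ (n - k) * q / ?d ^ (2 * n)\<close> for the coset.\<close>
  define q where "q = (\<Sum>A\<leftarrow>As. \<Sum>s\<in>?B. (cmod (overlap k x A s))\<^sup>2)"
  have scale: "(\<Sum>A\<leftarrow>As. f A / c) = (\<Sum>A\<leftarrow>As. f A) / c" for f :: "_ \<Rightarrow> real" and c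
    by (induction As) (auto simp: add_divide_distrib)
  have "(\<Sum>s\<in>?B. ent_fid (Bn n) (\<lambda>a b. code_proj \<omega> n k h v0 s a b / of_nat (CARD('p) ^ k))
      (cp_comp (Bn n) [recovery_op \<omega> n k h v0 xhat s t] As))
    = (\<Sum>s\<in>?B. \<Sum>A\<leftarrow>As. (cmod (overlap k x A s))\<^sup>2 / ?d ^ (2 * k))"
    using x t_len unfolding x_def by (intro sum.cong refl ent_fid_recovery[OF k_le]) auto
  also have "\<dots> = q / ?d ^ (2 * k)"
    by (simp add: q_def sum_list_sum scale flip: sum_divide_distrib)
  finally have lhs: "(\<Sum>s\<in>?B. ent_fid (Bn n) (\<lambda>a b. code_proj \<omega> n k h v0 s a b / of_nat (CARD('p) ^ k))
      (cp_comp (Bn n) [recovery_op \<omega> n k h v0 xhat s t] As)) = q / ?d ^ (2 * k)" .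
  have "(\<Sum>z\<in>{vadd x y | y. y \<in> L}. P_err \<omega> n As z) = (\<Sum>c\<in>?B. P_err \<omega> n As (vadd x (?y c)))"
    unfolding coset by (simp add: sum.reindex[OF inj])
  also have "\<dots> = complex_of_real (\<Sum>A\<leftarrow>As. (\<Sum>c\<in>?B.
      (cmod (trace (Bn n) (mmul (Bn n) (adj (Npauli \<omega> n (vadd x (?y c)))) A)))\<^sup>2) / ?d ^ (2 * n))"
    by (simp only: P_err_eq of_real_sum[symmetric] sum_list_sum sum_divide_distrib)
  also have "\<dots> = complex_of_real (?d ^ (n - k) * q / ?d ^ (2 * n))"
    unfolding sum_norm_trace_coset[OF k_le x(1)] scale q_def by (simp add: sum_list_const_mult)
  also have "?d ^ (n - k) * q / ?d ^ (2 * n) = 1 / ?d ^ (n - k) * (q / ?d ^ (2 * k))"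
  proof -
    have "?d ^ (2 * n) = ?d ^ (n - k) * ?d ^ (n - k) * ?d ^ (2 * k)"
      using k_le by (simp flip: power_add)
    then show ?thesis by simp
  qed
  finally show ?thesis unfolding lhs x_def by simp
qed

end
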